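(* Let $G=(G^0,G^1,\mathrm{s},\mathrm{t})$ be a directed graph with no infinite receivers, and let $p:G^0\sqcup G^1\to\mathbb{N}$ be a function such that (1) $p(e)\le p(\mathrm{t}(e))$ for all $e\in G^1$; (2) if $v\in G^0$ is a source then $p(v)=0$; and (3) if $v\in G^0$ is not a source then the function $p:\mathrm{t}^{-1}(v)\to\{0,1,\dots,p(v)\}$ is surjective. Let $G_{\mathrm{is},p}$ be the in-splitting of $G$ determined by $p$. For each category $\mathsf{C}$ with binary coproducts there is an equivalence of categories $$\mathsf{Diag}^{\sqcup}_{\mathsf{C}}(G)\cong \mathsf{Diag}^{\sqcup}_{\mathsf{C}}(G_{\mathrm{is},p}).$$
   Context: A directed graph $G=(G^0,G^1,\mathrm{s},\mathrm{t})$ consists of a nonempty set $G^0$ of vertices, a set $G^1$ of edges, and source and target maps $\mathrm{s},\mathrm{t}:G^1\to G^0$ (the sets may be infinite). A vertex $v$ is a source if $\mathrm{t}^{-1}(v)=\emptyset$, and an infinite receiver if $\mathrm{t}^{-1}(v)$ is infinite. Here $\mathbb{N}=\{0,1,2,\dots\}$. The in-splitting $G_{\mathrm{is},p}=(G_{\mathrm{is},p}^0,G_{\mathrm{is},p}^1,\mathrm{s}_{\mathrm{is},p},\mathrm{t}_{\mathrm{is},p})$ is the directed graph with $G_{\mathrm{is},p}^0=\{(v,n)\mid v\in G^0,\ 0\le n\le p(v)\}$, $G_{\mathrm{is},p}^1=\{(e,n)\mid e\in G^1,\ 0\le n\le p(\mathrm{s}(e))\}$, $\mathrm{s}_{\mathrm{is},p}(e,n)=(\mathrm{s}(e),n)$,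 $\mathrm{t}_{\mathrm{is},p}(e,n)=(\mathrm{t}(e),p(e))$ (with $n\in\mathbb{N}$). A category has binary coproducts if every pair of objects has a coproduct (equivalently, every family of objects indexed by a finite nonempty set has a coproduct). For a category $\mathsf{C}$, a diagram $D$ in $\mathsf{C}$ of shape $G$ consists of an object $D_v$ of $\mathsf{C}$ for each $v\in G^0$ and a morphism $D_e:D_{\mathrm{s}(e)}\to D_{\mathrm{t}(e)}$ for each $e\in G^1$. A morphism $T:D\to E$ consists of morphisms $T_v:D_v\to E_v$ ($v\in G^0$) with $T_{\mathrm{t}(e)}\circ D_e=E_e\circ T_{\mathrm{s}(e)}$ for all $e\in G^1$. The diagram $D$ satisfies the coproduct condition if for every vertex $v$ that is not a source, the family of morphisms $(D_e:D_{\mathrm{s}(e)}\to D_v\mid e\in \mathrm{t}^{-1}(v))$ makes $D_v$ a coproduct in $\mathsf{C}$ of the family $(D_{\mathrm{s}(e)}\mid e\in \mathrm{t}^{-1}(v))$. $\mathsf{Diag}^{\sqcup}_{\mathsf{C}}(G)$ is the category of diagrams in $\mathsf{C}$ of shape $G$ satisfying the coproduct condition, with all morphisms of diagrams between them. *)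

theory Defs
  imports "HOL-Library.FuncSet" "Graph_Theory.Digraph"
begin

section \<open>Categories, functors and equivalences\<close>

record ('o, 'm) pre_category =
  Obj :: "'o set"
  Arr :: "'m set"
  Dom :: "'m \<Rightarrow> 'o"
  Cod :: "'m \<Rightarrow> 'o"
  Ident :: "'o \<Rightarrow> 'm"
  Comp :: "'m \<Rightarrow> 'm \<Rightarrow> 'm"  \<comment> \<open>applicative order: \<open>Comp C g f\<close> is \<open>g\<close> after \<open>f\<close>\<close>

definition Hom :: "('o, 'm) pre_category \<Rightarrow> 'o \<Rightarrow> 'o \<Rightarrow> 'm set" where
  "Hom C X Y = {f \<in> Arr C. Dom C f = X \<and> Cod C f = Y}"

locale category =
  fixes C :: "('o, 'm) pre_category"
  assumes dom_obj: "f \<in> Arr C \<Longrightarrow> Dom C f \<in> Obj C"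
    and cod_obj: "f \<in> Arr C \<Longrightarrow> Cod C f \<in> Obj C"
    and id_hom: "X \<in> Obj C \<Longrightarrow> Ident C X \<in> Hom C X X"
    and comp_hom: "\<lbrakk>f \<in> Hom C X Y; g \<in> Hom C Y Z\<rbrakk> \<Longrightarrow> Comp C g f \<in> Hom C X Z"
    and comp_id_right: "f \<in> Hom C X Y \<Longrightarrow> Comp C f (Ident C X) = f"
    and comp_id_left: "f \<in> Hom C X Y \<Longrightarrow> Comp C (Ident C Y) f = f"
    and comp_assoc: "\<lbrakk>f \<in> Hom C W X; g \<in> Hom C X Y; h \<in> Hom C Y Z\<rbrakk>
      \<Longrightarrow> Comp C h (Comp C g f) = Comp C (Comp C h g) f"

definition is_iso :: "('o, 'm) pre_category \<Rightarrow> 'o \<Rightarrow> 'o \<Rightarrow> 'm \<Rightarrow> bool" where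
  "is_iso C X Y f \<longleftrightarrow> f \<in> Hom C X Y \<and>
    (\<exists>g \<in> Hom C Y X. Comp C g f = Ident C X \<and> Comp C f g = Ident C Y)"

record ('o, 'm, 'p, 'n) functor_data =
  on_obj :: "'o \<Rightarrow> 'p"
  on_arr :: "'m \<Rightarrow> 'n"

locale is_functor = A: category A + B: category B
  for A :: "('o, 'm) pre_category" and B :: "('p, 'n) pre_category" +
  fixes F :: "('o, 'm, 'p, 'n) functor_data"
  assumes on_obj_mem: "X \<in> Obj A \<Longrightarrow> on_obj F X \<in> Obj B"
    and on_arr_hom: "f \<in> Hom A X Y \<Longrightarrow> on_arr F f \<in> Hom B (on_obj F X) (on_obj F Y)"
    and on_arr_id: "X \<in> Obj A \<Longrightarrow> on_arr F (Ident A X) = Ident B (on_obj F X)"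
    and on_arr_comp: "\<lbrakk>f \<in> Hom A X Y; g \<in> Hom A Y Z\<rbrakk>
      \<Longrightarrow> on_arr F (Comp A g f) = Comp B (on_arr F g) (on_arr F f)"

definition functor_id :: "('o, 'm, 'o, 'm) functor_data" where
  "functor_id = \<lparr>on_obj = (\<lambda>X. X), on_arr = (\<lambda>f. f)\<rparr>"

definition functor_comp ::
    "('p, 'n, 'q, 'k) functor_data \<Rightarrow> ('o, 'm, 'p, 'n) functor_data \<Rightarrow> ('o, 'm, 'q, 'k) functor_data" where
  "functor_comp H F = \<lparr>on_obj = on_obj H \<circ> on_obj F, on_arr = on_arr H \<circ> on_arr F\<rparr>"

definition is_natural_iso ::
    "('o, 'm) pre_category \<Rightarrow> ('p, 'n) pre_category \<Rightarrow> ('o, 'm, 'p, 'n) functor_data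
      \<Rightarrow> ('o, 'm, 'p, 'n) functor_data \<Rightarrow> ('o \<Rightarrow> 'n) \<Rightarrow> bool" where
  "is_natural_iso A B F H \<tau> \<longleftrightarrow>
    (\<forall>X \<in> Obj A. is_iso B (on_obj F X) (on_obj H X) (\<tau> X)) \<and>
    (\<forall>X \<in> Obj A. \<forall>Y \<in> Obj A. \<forall>f \<in> Hom A X Y.
      Comp B (\<tau> Y) (on_arr F f) = Comp B (on_arr H f) (\<tau> X))"

definition equivalent_categories :: "('o, 'm) pre_category \<Rightarrow> ('p, 'n) pre_category \<Rightarrow> bool" where
  "equivalent_categories A B \<longleftrightarrow> (\<exists>F H \<eta> \<epsilon>.
    is_functor A B F \<and> is_functor B A H \<and>
    is_natural_iso A A functor_id (functor_comp H F) \<eta> \<and>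
    is_natural_iso B B (functor_comp F H) functor_id \<epsilon>)"


section \<open>Coproducts\<close>

definition is_coproduct ::
    "('o, 'm) pre_category \<Rightarrow> 'i set \<Rightarrow> ('i \<Rightarrow> 'o) \<Rightarrow> 'o \<Rightarrow> ('i \<Rightarrow> 'm) \<Rightarrow> bool" where
  "is_coproduct C I X Y \<iota> \<longleftrightarrow>
    Y \<in> Obj C \<and> (\<forall>i \<in> I. X i \<in> Obj C \<and> \<iota> i \<in> Hom C (X i) Y) \<and>
    (\<forall>Z \<in> Obj C. \<forall>f. (\<forall>i \<in> I. f i \<in> Hom C (X i) Z) \<longrightarrow>
      (\<exists>!h. h \<in> Hom C Y Z \<and> (\<forall>i \<in> I. Comp C h (\<iota> i) = f i)))"

text \<open>Pairs of objects are families indexed by \<^typ>\<open>bool\<close>.\<close>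

definition has_binary_coproducts :: "('o, 'm) pre_category \<Rightarrow> bool" where
  "has_binary_coproducts C \<longleftrightarrow> (\<forall>X \<in> Obj C. \<forall>Y \<in> Obj C. \<exists>Z \<iota>.
    is_coproduct C (UNIV :: bool set) (case_bool X Y) Z \<iota>)"


section \<open>Diagrams of the shape of a directed graph\<close>

text \<open>
  For a \<^typ>\<open>('v, 'e) pre_digraph\<close>, \<^const>\<open>tail\<close> is the source map and \<^const>\<open>head\<close> the target map,
  so that \<^term>\<open>in_arcs G v\<close> is the fibre of the target map over \<open>v\<close>.
\<close>

definition is_source :: "('v, 'e) pre_digraph \<Rightarrow> 'v \<Rightarrow> bool" where
  "is_source G v \<longleftrightarrow> in_arcs G v = {}"

definition infinite_receiver :: "('v, 'e) pre_digraph \<Rightarrow> 'v \<Rightarrow> bool" where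
  "infinite_receiver G v \<longleftrightarrow> infinite (in_arcs G v)"

record ('v, 'e, 'o, 'm) diagram =
  at_vert :: "'v \<Rightarrow> 'o"
  at_arc :: "'e \<Rightarrow> 'm"

text \<open>
  The components of diagrams and of their morphisms are functions on the vertices and arcs of the
  graph, hence required to be \<^const>\<open>undefined\<close> elsewhere.
\<close>

definition is_diagram :: "('o, 'm) pre_category \<Rightarrow> ('v, 'e) pre_digraph \<Rightarrow> ('v, 'e, 'o, 'm) diagram \<Rightarrow> bool" where
  "is_diagram C G D \<longleftrightarrow>
    at_vert D \<in> verts G \<rightarrow>\<^sub>E Obj C \<and>
    at_arc D \<in> (\<Pi>\<^sub>E e \<in> arcs G. Hom C (at_vert D (tail G e)) (at_vert D (head G e)))"

definition coproduct_condition ::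
    "('o, 'm) pre_category \<Rightarrow> ('v, 'e) pre_digraph \<Rightarrow> ('v, 'e, 'o, 'm) diagram \<Rightarrow> bool" where
  "coproduct_condition C G D \<longleftrightarrow> (\<forall>v \<in> verts G. \<not> is_source G v \<longrightarrow>
    is_coproduct C (in_arcs G v) (\<lambda>e. at_vert D (tail G e)) (at_vert D v) (at_arc D))"

record ('v, 'e, 'o, 'm) diagram_mor =
  mor_dom :: "('v, 'e, 'o, 'm) diagram"
  mor_cod :: "('v, 'e, 'o, 'm) diagram"
  component :: "'v \<Rightarrow> 'm"

definition is_diagram_mor ::
    "('o, 'm) pre_category \<Rightarrow> ('v, 'e) pre_digraph \<Rightarrow> ('v, 'e, 'o, 'm) diagram_mor \<Rightarrow> bool" where
  "is_diagram_mor C G T \<longleftrightarrow>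
    component T \<in> (\<Pi>\<^sub>E v \<in> verts G. Hom C (at_vert (mor_dom T) v) (at_vert (mor_cod T) v)) \<and>
    (\<forall>e \<in> arcs G. Comp C (component T (head G e)) (at_arc (mor_dom T) e)
                  = Comp C (at_arc (mor_cod T) e) (component T (tail G e)))"

definition Diag_coprod ::
    "('o, 'm) pre_category \<Rightarrow> ('v, 'e) pre_digraph
      \<Rightarrow> (('v, 'e, 'o, 'm) diagram, ('v, 'e, 'o, 'm) diagram_mor) pre_category" where
  "Diag_coprod C G =
    (let Ob = {D. is_diagram C G D \<and> coproduct_condition C G D} in
     \<lparr>Obj = Ob,
      Arr = {T. mor_dom T \<in> Ob \<and> mor_cod T \<in> Ob \<and> is_diagram_mor C G T},
      Dom = mor_dom,
      Cod = mor_cod,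
      Ident = (\<lambda>D. \<lparr>mor_dom = D, mor_cod = D, component = (\<lambda>v \<in> verts G. Ident C (at_vert D v))\<rparr>),
      Comp = (\<lambda>S T. \<lparr>mor_dom = mor_dom T, mor_cod = mor_cod S,
                component = (\<lambda>v \<in> verts G. Comp C (component S v) (component T v))\<rparr>)\<rparr>)"

lemma category_Diag_coprod:
  assumes "category C" and "wf_digraph G"
  shows "category (Diag_coprod C G)"
proof -
  interpret category C by fact
  interpret G: wf_digraph G by fact
  have mor: "T \<in> Hom (Diag_coprod C G) D E \<longleftrightarrow>
      mor_dom T = D \<and> mor_cod T = E \<and> is_diagram C G D \<and> coproduct_condition C G D \<and>
      is_diagram C G E \<and> coproduct_condition C G E \<and> is_diagram_mor C G T" for T D E
    by (auto simp: Hom_def Diag_coprod_def Let_def)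
  have comp: "component (Comp (Diag_coprod C G) S T) =
      (\<lambda>v \<in> verts G. Comp C (component S v) (component T v))"
    "mor_dom (Comp (Diag_coprod C G) S T) = mor_dom T"
    "mor_cod (Comp (Diag_coprod C G) S T) = mor_cod S" for S T
    by (simp_all add: Diag_coprod_def Let_def)
  have ident: "component (Ident (Diag_coprod C G) D) = (\<lambda>v \<in> verts G. Ident C (at_vert D v))"
    "mor_dom (Ident (Diag_coprod C G) D) = D" "mor_cod (Ident (Diag_coprod C G) D) = D" for D
    by (simp_all add: Diag_coprod_def Let_def)
  have cmp: "component T v \<in> Hom C (at_vert (mor_dom T) v) (at_vert (mor_cod T) v)"
    if "is_diagram_mor C G T" "v \<in> verts G" for T v
    using that by (auto simp: is_diagram_mor_def)
  have ext: "component T v = undefined" if "is_diagram_mor C G T" "v \<notin> verts G" for T v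
    using that by (auto simp: is_diagram_mor_def PiE_def extensional_def)
  have arc: "at_arc D e \<in> Hom C (at_vert D (tail G e)) (at_vert D (head G e))"
    if "is_diagram C G D" "e \<in> arcs G" for D e
    using that by (auto simp: is_diagram_def)
  have vert: "at_vert D v \<in> Obj C" if "is_diagram C G D" "v \<in> verts G" for D v
    using that by (auto simp: is_diagram_def)
  show ?thesis
  proof
    fix T assume "T \<in> Arr (Diag_coprod C G)"
    then show "Dom (Diag_coprod C G) T \<in> Obj (Diag_coprod C G)"
      "Cod (Diag_coprod C G) T \<in> Obj (Diag_coprod C G)"
      by (auto simp: Diag_coprod_def Let_def)
  next
    fix D assume "D \<in> Obj (Diag_coprod C G)"
    then have D: "is_diagram C G D" "coproduct_condition C G D"
      by (auto simp: Diag_coprod_def Let_def)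
    have "is_diagram_mor C G (Ident (Diag_coprod C G) D)"
      unfolding is_diagram_mor_def ident
      using arc[OF D(1), THEN comp_id_left] arc[OF D(1), THEN comp_id_right] vert[OF D(1)]
      by (auto simp: id_hom)
    with D show "Ident (Diag_coprod C G) D \<in> Hom (Diag_coprod C G) D D"
      by (simp add: mor ident)
  next
    fix T D E S F
    assume T: "T \<in> Hom (Diag_coprod C G) D E" and S: "S \<in> Hom (Diag_coprod C G) E F"
    have nat: "Comp C (Comp C (component S (head G e)) (component T (head G e))) (at_arc D e) =
        Comp C (at_arc F e) (Comp C (component S (tail G e)) (component T (tail G e)))"
      if e: "e \<in> arcs G" for e
    proof -
      have h: "head G e \<in> verts G" and t: "tail G e \<in> verts G"
        using e by auto
      have Th: "component T (head G e) \<in> Hom C (at_vert D (head G e)) (at_vert E (head G e))"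
        and Tt: "component T (tail G e) \<in> Hom C (at_vert D (tail G e)) (at_vert E (tail G e))"
        using T cmp[OF _ h] cmp[OF _ t] by (auto simp: mor)
      have Sh: "component S (head G e) \<in> Hom C (at_vert E (head G e)) (at_vert F (head G e))"
        and St: "component S (tail G e) \<in> Hom C (at_vert E (tail G e)) (at_vert F (tail G e))"
        using S cmp[OF _ h] cmp[OF _ t] by (auto simp: mor)
      have a: "is_diagram C G D" "is_diagram C G E" "is_diagram C G F"
        using T S by (auto simp: mor)
      have nT: "Comp C (component T (head G e)) (at_arc D e)
          = Comp C (at_arc E e) (component T (tail G e))"
        using T e by (auto simp: mor is_diagram_mor_def)
      have nS: "Comp C (component S (head G e)) (at_arc E e)
          = Comp C (at_arc F e) (component S (tail G e))"
        using S e by (auto simp: mor is_diagram_mor_def)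
      show ?thesis
        using comp_assoc[OF arc[OF a(1) e] Th Sh] comp_assoc[OF Tt arc[OF a(2) e] Sh]
          comp_assoc[OF Tt St arc[OF a(3) e]] nT nS by simp
    qed
    show "Comp (Diag_coprod C G) S T \<in> Hom (Diag_coprod C G) D F"
      using T S nat unfolding mor comp is_diagram_mor_def
      by (auto intro!: comp_hom)
  next
    fix T D E assume T: "T \<in> Hom (Diag_coprod C G) D E"
    show "Comp (Diag_coprod C G) T (Ident (Diag_coprod C G) D) = T"
      "Comp (Diag_coprod C G) (Ident (Diag_coprod C G) E) T = T"
      using T cmp[of T] ext[of T]
      by (auto intro!: diagram_mor.equality comp_id_right comp_id_left
          simp: mor comp ident fun_eq_iff restrict_def)
  next
    fix R S T D E F K
    assume "T \<in> Hom (Diag_coprod C G) D E" "S \<in> Hom (Diag_coprod C G) E F"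
      "R \<in> Hom (Diag_coprod C G) F K"
    then show "Comp (Diag_coprod C G) R (Comp (Diag_coprod C G) S T) =
        Comp (Diag_coprod C G) (Comp (Diag_coprod C G) R S) T"
      using cmp[of T] cmp[of S] cmp[of R]
      by (auto intro!: diagram_mor.equality comp_assoc simp: mor comp fun_eq_iff restrict_def)
  qed
qed


section \<open>In-splittings\<close>

definition in_splitting ::
    "('v, 'e) pre_digraph \<Rightarrow> ('v + 'e \<Rightarrow> nat) \<Rightarrow> ('v \<times> nat, 'e \<times> nat) pre_digraph" where
  "in_splitting G p =
    \<lparr>verts = {(v, n). v \<in> verts G \<and> n \<le> p (Inl v)},
     arcs = {(e, n). e \<in> arcs G \<and> n \<le> p (Inl (tail G e))},
     tail = (\<lambda>(e, n). (tail G e, n)),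
     head = (\<lambda>(e, n). (head G e, p (Inr e)))\<rparr>"

lemma wf_digraph_in_splitting:
  assumes "wf_digraph G" and "\<And>e. e \<in> arcs G \<Longrightarrow> p (Inr e) \<le> p (Inl (head G e))"
  shows "wf_digraph (in_splitting G p)"
proof -
  interpret wf_digraph G by fact
  show ?thesis
    by standard (auto simp: in_splitting_def assms(2))
qed

end

theory Submission
  imports Defs
begin

text \<open>
  Write \<open>S\<close> for the in-splitting. A diagram \<open>D'\<close> on \<open>S\<close> should correspond to the diagram \<open>D\<close> on \<open>G\<close>
  whose object at \<open>v\<close> is the coproduct of the objects \<open>D'\<^sub>v\<^sub>,\<^sub>n\<close> for \<open>n \<le> p v\<close>; conversely, \<open>D'\<^sub>v\<^sub>,\<^sub>n\<close> is the part of
  the coproduct \<open>D\<^sub>v\<close> contributed by the arcs \<open>e\<close> into \<open>v\<close> with label \<open>p e = n\<close>. Neither passage is canonical, since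
  coproducts must be chosen. The proof therefore works with a symmetric notion: a \<^emph>\<open>link\<close> between \<open>D\<close>
  and \<open>D'\<close> is a family \<open>q\<^sub>v\<^sub>,\<^sub>n : D'\<^sub>v\<^sub>,\<^sub>n \<rightarrow> D\<^sub>v\<close> that presents each \<open>D\<^sub>v\<close> as a coproduct and satisfies
  \<open>D\<^sub>e \<circ> q = q \<circ> D'\<^sub>e\<^sub>,\<^sub>n\<close> for every arc. Given links from \<open>D\<close> to \<open>D'\<close> by \<open>q\<close> and from \<open>E\<close> to \<open>E'\<close> by \<open>r\<close>,
  morphisms \<open>T : D \<rightarrow> E\<close> and \<open>T' : D' \<rightarrow> E'\<close> are linked if \<open>T\<^sub>v \<circ> q\<^sub>v\<^sub>,\<^sub>n = r\<^sub>v\<^sub>,\<^sub>n \<circ> T'\<^sub>v\<^sub>,\<^sub>n\<close>.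

  Two categories are equivalent as soon as every object on either side is linked to some object on the
  other side, and linked morphisms correspond bijectively, compatibly with composition
  (\<open>equivalent_of_links\<close>). The existence of linked objects (\<open>merge_ex\<close>, \<open>split_ex\<close>) is associativity of
  coproducts (\<open>coproduct_group_iff\<close>), applied to the arcs into a vertex \<open>v\<close> of \<open>G\<close> together with a level
  \<open>n \<le> p u\<close> of their source \<open>u\<close>: this set can be grouped by the label of the arc, as in \<open>S\<close>, or by the arc itself, as in \<open>G\<close>.

  That a morphism \<open>T'\<close> determines \<open>T\<close> (\<open>merge_mor_ex1\<close>) is the universal property of \<open>D\<^sub>v\<close>. The converse
  (\<open>split_mor_ex1\<close>) is less obvious, because coproduct injections need not be monic. The coproduct
  condition helps: the arcs \<open>E'\<^sub>e\<^sub>,\<^sub>n\<close>, for varying \<open>n\<close>, assemble to a map \<open>a\<^sub>e\<close> from \<open>E\<close> at the source of \<open>e\<close>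
  to \<open>E'\<close> at the target of \<open>(e, n)\<close>, and a linked morphism has to satisfy
  \<open>T' \<circ> D'\<^sub>e\<^sub>,\<^sub>n = E'\<^sub>e\<^sub>,\<^sub>n \<circ> T' = a\<^sub>e \<circ> r \<circ> T' = a\<^sub>e \<circ> T \<circ> q\<close>.
  This prescribes \<open>T'\<close> on a coproduct presentation of \<open>D'\<^sub>v\<^sub>,\<^sub>n\<close>. At a source there is only one level,
  and \<open>r\<close> is an isomorphism there.
\<close>

section \<open>Equivalences from linked objects\<close>

text \<open>
  \<open>L X Y l\<close> says that \<open>l\<close> links \<open>X\<close> to \<open>Y\<close>, and \<open>M l l' f g\<close> that \<open>f\<close> and \<open>g\<close> correspond along the links
  \<open>l\<close> and \<open>l'\<close>. Linked pairs are the objects of a category whose projections to \<open>A\<close> and \<open>B\<close> are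
  both fully faithful and surjective on objects; the conditions below describe it without naming it.
\<close>
locale linked_categories = A: category A + B: category B
  for A :: "('o, 'm) pre_category" and B :: "('p, 'n) pre_category" +
  fixes L :: "'o \<Rightarrow> 'p \<Rightarrow> 'l \<Rightarrow> bool"
    and M :: "'l \<Rightarrow> 'l \<Rightarrow> 'm \<Rightarrow> 'n \<Rightarrow> bool"
  assumes link_obj: "L X Y l \<Longrightarrow> X \<in> Obj A \<and> Y \<in> Obj B"
    and link_right_ex: "X \<in> Obj A \<Longrightarrow> \<exists>Y l. L X Y l"
    and link_left_ex: "Y \<in> Obj B \<Longrightarrow> \<exists>X l. L X Y l"
    and mor_right_ex1: "\<lbrakk>L X Y l; L X' Y' l'; f \<in> Hom A X X'\<rbrakk> \<Longrightarrow> \<exists>!g. g \<in> Hom B Y Y' \<and> M l l' f g"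
    and mor_left_ex1: "\<lbrakk>L X Y l; L X' Y' l'; g \<in> Hom B Y Y'\<rbrakk> \<Longrightarrow> \<exists>!f. f \<in> Hom A X X' \<and> M l l' f g"
    and mor_ident: "L X Y l \<Longrightarrow> M l l (Ident A X) (Ident B Y)"
    and mor_comp: "\<lbrakk>L X Y l; L X' Y' l'; L X'' Y'' l'';
        f \<in> Hom A X X'; f' \<in> Hom A X' X''; g \<in> Hom B Y Y'; g' \<in> Hom B Y' Y'';
        M l l' f g; M l' l'' f' g'\<rbrakk> \<Longrightarrow> M l l'' (Comp A f' f) (Comp B g' g)"
begin

lemma linked_categories_swap: "linked_categories B A (\<lambda>Y X. L X Y) (\<lambda>l l' g f. M l l' f g)"
proof unfold_locales
  show "M l l'' (Comp A g' g) (Comp B f' f)"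
    if "L Y X l" "L Y' X' l'" "L Y'' X'' l''"
      "f \<in> Hom B X X'" "f' \<in> Hom B X' X''" "g \<in> Hom A Y Y'" "g' \<in> Hom A Y' Y''"
      "M l l' g f" "M l' l'' g' f'" for X Y l X' Y' l' X'' Y'' l'' f f' g g'
    using mor_comp[OF that(1-3) that(6,7,4,5) that(8,9)] .
qed (blast dest: link_obj | erule link_right_ex link_left_ex mor_ident
    | erule (2) mor_left_ex1 mor_right_ex1)+

lemma mor_right_unique:
  "\<lbrakk>L X Y l; L X' Y' l'; f \<in> Hom A X X'; g \<in> Hom B Y Y'; g' \<in> Hom B Y Y';
    M l l' f g; M l l' f g'\<rbrakk> \<Longrightarrow> g = g'"
  using mor_right_ex1 by blast

text \<open>
  Chosen links determine the action on morphisms, and functoriality is uniqueness of corresponding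
  morphisms.
\<close>
lemma functor_along_links:
  assumes lk: "\<And>X. X \<in> Obj A \<Longrightarrow> L X (\<Phi> X) (l X)"
  obtains F where "on_obj F = \<Phi>" and "is_functor A B F"
    and "\<And>X X' f. f \<in> Hom A X X' \<Longrightarrow> M (l X) (l X') f (on_arr F f)"
proof -
  define F where "F = \<lparr>on_obj = \<Phi>, on_arr = (\<lambda>f. THE g. g \<in> Hom B (\<Phi> (Dom A f)) (\<Phi> (Cod A f)) \<and>
    M (l (Dom A f)) (l (Cod A f)) f g)\<rparr>"
  have F_obj: "on_obj F = \<Phi>" by (simp add: F_def)
  have objs: "X \<in> Obj A" "X' \<in> Obj A" if "f \<in> Hom A X X'" for f X X'
    using that A.dom_obj A.cod_obj by (auto simp: Hom_def)
  have F_arr: "on_arr F f \<in> Hom B (\<Phi> X) (\<Phi> X') \<and> M (l X) (l X') f (on_arr F f)"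
    if f: "f \<in> Hom A X X'" for f X X'
  proof -
    have "Dom A f = X" "Cod A f = X'" using f by (auto simp: Hom_def)
    then show ?thesis
      using theI'[OF mor_right_ex1[OF lk[OF objs(1)[OF f]] lk[OF objs(2)[OF f]] f]]
      by (simp add: F_def)
  qed
  have "is_functor A B F"
  proof
    show "on_obj F X \<in> Obj B" if "X \<in> Obj A" for X
      using link_obj[OF lk[OF that]] F_obj by simp
    show "on_arr F f \<in> Hom B (on_obj F X) (on_obj F Y)" if "f \<in> Hom A X Y" for f X Y
      using F_arr[OF that] F_obj by simp
    show "on_arr F (Ident A X) = Ident B (on_obj F X)" if X: "X \<in> Obj A" for X
      using mor_right_unique[OF lk[OF X] lk[OF X] A.id_hom[OF X]] F_arr[OF A.id_hom[OF X]]
        B.id_hom link_obj[OF lk[OF X]] mor_ident[OF lk[OF X]] F_obj by simp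
    show "on_arr F (Comp A g f) = Comp B (on_arr F g) (on_arr F f)"
      if f: "f \<in> Hom A X Y" and g: "g \<in> Hom A Y Z" for f g X Y Z
    proof (rule mor_right_unique[OF lk lk A.comp_hom[OF f g]])
      show "M (l X) (l Z) (Comp A g f) (Comp B (on_arr F g) (on_arr F f))"
        using mor_comp[OF lk lk lk f g] F_arr[OF f] F_arr[OF g] objs[OF f] objs[OF g] by blast
    qed (use F_arr[OF A.comp_hom[OF f g]] F_arr[OF f] F_arr[OF g] objs[OF f] objs[OF g]
        in \<open>auto intro: B.comp_hom\<close>)
  qed
  with F_obj F_arr show thesis by (intro that) auto
qed

text \<open>
  Two objects linked to the same \<open>Y\<close> are isomorphic through the morphisms that correspond to the
  identity of \<open>Y\<close>. This provides unit and counit.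
\<close>
lemma iso_of_common_link:
  assumes l: "L X Y l" and l': "L X' Y l'"
  shows "\<exists>f. is_iso A X X' f \<and> M l l' f (Ident B Y)"
proof -
  have Y: "Y \<in> Obj B" and X: "X \<in> Obj A" "X' \<in> Obj A" using link_obj l l' by auto
  note idY = B.id_hom[OF Y]
  obtain f where f: "f \<in> Hom A X X'" "M l l' f (Ident B Y)"
    using mor_left_ex1[OF l l' idY] by auto
  obtain g where g: "g \<in> Hom A X' X" "M l' l g (Ident B Y)"
    using mor_left_ex1[OF l' l idY] by auto
  have "M l l (Comp A g f) (Ident B Y)" "M l' l' (Comp A f g) (Ident B Y)"
    using mor_comp[OF l l' l f(1) g(1) idY idY f(2) g(2)]
      mor_comp[OF l' l l' g(1) f(1) idY idY g(2) f(2)] B.comp_id_left[OF idY] by auto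
  then have "Comp A g f = Ident A X" "Comp A f g = Ident A X'"
    using mor_left_ex1[OF l l idY] mor_left_ex1[OF l' l' idY] mor_ident[OF l] mor_ident[OF l']
      A.comp_hom[OF f(1) g(1)] A.comp_hom[OF g(1) f(1)] A.id_hom X by blast+
  with f g show ?thesis by (auto simp: is_iso_def)
qed

theorem equivalent_of_links: "equivalent_categories A B"
proof -
  interpret S: linked_categories B A "\<lambda>Y X. L X Y" "\<lambda>l l' g f. M l l' f g" by (rule linked_categories_swap)
  obtain \<Phi> l where l: "\<And>X. X \<in> Obj A \<Longrightarrow> L X (\<Phi> X) (l X)" using link_right_ex by metis
  obtain \<Psi> m where m: "\<And>Y. Y \<in> Obj B \<Longrightarrow> L (\<Psi> Y) Y (m Y)" using link_left_ex by metis
  obtain F where F: "on_obj F = \<Phi>" "is_functor A B F"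
    "\<And>X X' f. f \<in> Hom A X X' \<Longrightarrow> M (l X) (l X') f (on_arr F f)"
    using functor_along_links[OF l] by metis
  obtain H where H: "on_obj H = \<Psi>" "is_functor B A H"
    "\<And>Y Y' g. g \<in> Hom B Y Y' \<Longrightarrow> M (m Y) (m Y') (on_arr H g) g"
    using S.functor_along_links[OF m] by metis
  interpret F: is_functor A B F by (rule F(2))
  interpret H: is_functor B A H by (rule H(2))
  have \<Phi>: "\<Phi> X \<in> Obj B" if "X \<in> Obj A" for X using l[OF that] link_obj by blast
  have \<Psi>: "\<Psi> Y \<in> Obj A" if "Y \<in> Obj B" for Y using m[OF that] link_obj by blast
  have "\<forall>X\<in>Obj A. \<exists>f. is_iso A X (\<Psi> (\<Phi> X)) f \<and> M (l X) (m (\<Phi> X)) f (Ident B (\<Phi> X))"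
    using iso_of_common_link[OF l m] \<Phi> by blast
  then obtain \<eta> where \<eta>: "\<And>X. X \<in> Obj A \<Longrightarrow> is_iso A X (\<Psi> (\<Phi> X)) (\<eta> X)"
    "\<And>X. X \<in> Obj A \<Longrightarrow> M (l X) (m (\<Phi> X)) (\<eta> X) (Ident B (\<Phi> X))" by metis
  have "\<forall>Y\<in>Obj B. \<exists>g. is_iso B (\<Phi> (\<Psi> Y)) Y g \<and> M (l (\<Psi> Y)) (m Y) (Ident A (\<Psi> Y)) g"
    using S.iso_of_common_link[OF l m] \<Psi> by blast
  then obtain \<epsilon> where \<epsilon>: "\<And>Y. Y \<in> Obj B \<Longrightarrow> is_iso B (\<Phi> (\<Psi> Y)) Y (\<epsilon> Y)"
    "\<And>Y. Y \<in> Obj B \<Longrightarrow> M (l (\<Psi> Y)) (m Y) (Ident A (\<Psi> Y)) (\<epsilon> Y)" by metis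
  have "is_natural_iso A A functor_id (functor_comp H F) \<eta>"
    unfolding is_natural_iso_def
  proof (intro conjI ballI)
    fix X X' f assume X: "X \<in> Obj A" "X' \<in> Obj A" and f: "f \<in> Hom A X X'"
    have \<eta>h: "\<eta> X \<in> Hom A X (\<Psi> (\<Phi> X))" "\<eta> X' \<in> Hom A X' (\<Psi> (\<Phi> X'))"
      using \<eta>(1) X by (auto simp: is_iso_def)
    have Ff: "on_arr F f \<in> Hom B (\<Phi> X) (\<Phi> X')" using F.on_arr_hom[OF f] F(1) by simp
    have HFf: "on_arr H (on_arr F f) \<in> Hom A (\<Psi> (\<Phi> X)) (\<Psi> (\<Phi> X'))"
      using H.on_arr_hom[OF Ff] H(1) by simp
    note ids = B.id_hom[OF \<Phi>[OF X(1)]] B.id_hom[OF \<Phi>[OF X(2)]]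
    note ls = l[OF X(1)] l[OF X(2)] m[OF \<Phi>[OF X(1)]] m[OF \<Phi>[OF X(2)]]
    \<comment> \<open>Both sides of the naturality square correspond to \<open>F f\<close>, hence agree.\<close>
    have "M (l X) (m (\<Phi> X')) (Comp A (\<eta> X') f) (on_arr F f)"
      using mor_comp[OF ls(1,2,4) f \<eta>h(2) Ff ids(2) F(3)[OF f] \<eta>(2)[OF X(2)]]
        B.comp_id_left[OF Ff] by simp
    moreover have "M (l X) (m (\<Phi> X')) (Comp A (on_arr H (on_arr F f)) (\<eta> X)) (on_arr F f)"
      using mor_comp[OF ls(1,3,4) \<eta>h(1) HFf ids(1) Ff \<eta>(2)[OF X(1)] H(3)[OF Ff]]
        B.comp_id_right[OF Ff] by simp
    ultimately show "Comp A (\<eta> X') (on_arr functor_id f) =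
        Comp A (on_arr (functor_comp H F) f) (\<eta> X)"
      using S.mor_right_unique[OF ls(1,4) Ff A.comp_hom[OF f \<eta>h(2)] A.comp_hom[OF \<eta>h(1) HFf]]
      by (simp add: functor_id_def functor_comp_def)
  qed (use \<eta>(1) F(1) H(1) in \<open>simp add: functor_id_def functor_comp_def\<close>)
  moreover have "is_natural_iso B B (functor_comp F H) functor_id \<epsilon>"
    unfolding is_natural_iso_def
  proof (intro conjI ballI)
    fix Y Y' g assume Y: "Y \<in> Obj B" "Y' \<in> Obj B" and g: "g \<in> Hom B Y Y'"
    have \<epsilon>h: "\<epsilon> Y \<in> Hom B (\<Phi> (\<Psi> Y)) Y" "\<epsilon> Y' \<in> Hom B (\<Phi> (\<Psi> Y')) Y'"
      using \<epsilon>(1) Y by (auto simp: is_iso_def)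
    have Hg: "on_arr H g \<in> Hom A (\<Psi> Y) (\<Psi> Y')" using H.on_arr_hom[OF g] H(1) by simp
    have FHg: "on_arr F (on_arr H g) \<in> Hom B (\<Phi> (\<Psi> Y)) (\<Phi> (\<Psi> Y'))"
      using F.on_arr_hom[OF Hg] F(1) by simp
    note ids = A.id_hom[OF \<Psi>[OF Y(1)]] A.id_hom[OF \<Psi>[OF Y(2)]]
    note ls = l[OF \<Psi>[OF Y(1)]] l[OF \<Psi>[OF Y(2)]] m[OF Y(1)] m[OF Y(2)]
    have "M (l (\<Psi> Y)) (m Y') (on_arr H g) (Comp B (\<epsilon> Y') (on_arr F (on_arr H g)))"
      using mor_comp[OF ls(1,2,4) Hg ids(2) FHg \<epsilon>h(2) F(3)[OF Hg] \<epsilon>(2)[OF Y(2)]]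
        A.comp_id_left[OF Hg] by simp
    moreover have "M (l (\<Psi> Y)) (m Y') (on_arr H g) (Comp B g (\<epsilon> Y))"
      using mor_comp[OF ls(1,3,4) ids(1) Hg \<epsilon>h(1) g \<epsilon>(2)[OF Y(1)] H(3)[OF g]]
        A.comp_id_right[OF Hg] by simp
    ultimately show "Comp B (\<epsilon> Y') (on_arr (functor_comp F H) g) =
        Comp B (on_arr functor_id g) (\<epsilon> Y)"
      using mor_right_unique[OF ls(1,4) Hg B.comp_hom[OF FHg \<epsilon>h(2)] B.comp_hom[OF \<epsilon>h(1) g]]
      by (simp add: functor_id_def functor_comp_def)
  qed (use \<epsilon>(1) F(1) H(1) in \<open>simp add: functor_id_def functor_comp_def\<close>)
  ultimately show ?thesis
    unfolding equivalent_categories_def using F(2) H(2) by blast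
qed

end


section \<open>Associativity and existence of finite coproducts\<close>

lemma is_coproduct_cong:
  assumes "I = I'" and "\<And>i. i \<in> I' \<Longrightarrow> X i = X' i" and "\<And>i. i \<in> I' \<Longrightarrow> \<iota> i = \<iota>' i"
  shows "is_coproduct C I X Y \<iota> \<longleftrightarrow> is_coproduct C I' X' Y \<iota>'"
  unfolding is_coproduct_def using assms by (simp cong: ball_cong)

lemma is_coproduct_reindex:
  assumes "inj_on h J" and cop: "is_coproduct C J (\<lambda>j. X (h j)) Y (\<lambda>j. \<iota> (h j))"
  shows "is_coproduct C (h ` J) X Y \<iota>"
  unfolding is_coproduct_def
proof (intro conjI ballI allI impI)
  fix Z f assume "Z \<in> Obj C" and "\<forall>i\<in>h ` J. f i \<in> Hom C (X i) Z"
  then have "\<exists>!k. k \<in> Hom C Y Z \<and> (\<forall>j\<in>J. Comp C k (\<iota> (h j)) = f (h j))"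
    using cop unfolding is_coproduct_def by (elim conjE) (drule bspec, assumption, simp)
  then show "\<exists>!k. k \<in> Hom C Y Z \<and> (\<forall>i\<in>h ` J. Comp C k (\<iota> i) = f i)" by simp
qed (use cop in \<open>auto simp: is_coproduct_def\<close>)

lemma coproduct_obj: "is_coproduct C I X Y \<iota> \<Longrightarrow> Y \<in> Obj C"
  by (simp add: is_coproduct_def)

lemma coproduct_inj:
  "\<lbrakk>is_coproduct C I X Y \<iota>; i \<in> I\<rbrakk> \<Longrightarrow> \<iota> i \<in> Hom C (X i) Y"
  by (simp add: is_coproduct_def)

lemma coproduct_copair:
  assumes "is_coproduct C I X Y \<iota>" and "Z \<in> Obj C" and "\<And>i. i \<in> I \<Longrightarrow> f i \<in> Hom C (X i) Z"
  obtains h where "h \<in> Hom C Y Z" and "\<And>i. i \<in> I \<Longrightarrow> Comp C h (\<iota> i) = f i"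
  using assms unfolding is_coproduct_def by metis

context category
begin

lemma hom_obj:
  assumes "f \<in> Hom C X Y"
  shows "X \<in> Obj C" and "Y \<in> Obj C"
  using assms dom_obj cod_obj by (auto simp: Hom_def)

lemma coproduct_ext:
  assumes cop: "is_coproduct C I X Y \<iota>" and h: "h \<in> Hom C Y Z" and h': "h' \<in> Hom C Y Z"
    and eq: "\<And>i. i \<in> I \<Longrightarrow> Comp C h (\<iota> i) = Comp C h' (\<iota> i)"
  shows "h = h'"
proof -
  have "\<forall>i\<in>I. Comp C h' (\<iota> i) \<in> Hom C (X i) Z"
    using coproduct_inj[OF cop] h' by (blast intro: comp_hom)
  then have "\<exists>!k. k \<in> Hom C Y Z \<and> (\<forall>i\<in>I. Comp C k (\<iota> i) = Comp C h' (\<iota> i))"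
    using cop hom_obj(2)[OF h] unfolding is_coproduct_def
    by (elim conjE) (drule bspec, assumption, simp)
  with h h' eq show ?thesis by blast
qed

lemma is_coproductI:
  assumes "Y \<in> Obj C" and \<iota>: "\<And>i. i \<in> I \<Longrightarrow> \<iota> i \<in> Hom C (X i) Y"
    and ex: "\<And>Z f. \<lbrakk>Z \<in> Obj C; \<And>i. i \<in> I \<Longrightarrow> f i \<in> Hom C (X i) Z\<rbrakk>
      \<Longrightarrow> \<exists>h\<in>Hom C Y Z. \<forall>i\<in>I. Comp C h (\<iota> i) = f i"
    and ext: "\<And>Z h h'. \<lbrakk>h \<in> Hom C Y Z; h' \<in> Hom C Y Z;
      \<And>i. i \<in> I \<Longrightarrow> Comp C h (\<iota> i) = Comp C h' (\<iota> i)\<rbrakk> \<Longrightarrow> h = h'"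
  shows "is_coproduct C I X Y \<iota>"
  unfolding is_coproduct_def
proof (intro conjI ballI allI impI)
  fix Z f assume "Z \<in> Obj C" and "\<forall>i\<in>I. f i \<in> Hom C (X i) Z"
  then obtain h where h: "h \<in> Hom C Y Z" "\<forall>i\<in>I. Comp C h (\<iota> i) = f i" using ex by blast
  show "\<exists>!h. h \<in> Hom C Y Z \<and> (\<forall>i\<in>I. Comp C h (\<iota> i) = f i)"
  proof (rule ex1I)
    show "h' = h" if "h' \<in> Hom C Y Z \<and> (\<forall>i\<in>I. Comp C h' (\<iota> i) = f i)" for h'
      by (rule ext[of _ Z]) (use h that in auto)
  qed (use h in blast)
qed (use assms hom_obj in blast)+

text \<open>
  At a source vertex a link has a single leg; this makes the leg invertible.
\<close>
lemma singleton_coproduct_iso: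
  assumes cop: "is_coproduct C {i} X Y \<iota>"
  shows "is_iso C (X i) Y (\<iota> i)"
proof -
  have \<iota>: "\<iota> i \<in> Hom C (X i) Y" using coproduct_inj[OF cop] by simp
  note objs = hom_obj[OF \<iota>]
  obtain s where s: "s \<in> Hom C Y (X i)" "Comp C s (\<iota> i) = Ident C (X i)"
    using coproduct_copair[OF cop objs(1), of "\<lambda>_. Ident C (X i)"] id_hom[OF objs(1)] by auto
  have "Comp C (\<iota> i) s = Ident C Y"
  proof (rule coproduct_ext[OF cop comp_hom[OF s(1) \<iota>] id_hom[OF objs(2)]])
    fix j assume "j \<in> {i}"
    then show "Comp C (Comp C (\<iota> i) s) (\<iota> j) = Comp C (Ident C Y) (\<iota> j)"
      using comp_assoc[OF \<iota> s(1) \<iota>] s(2) comp_id_right[OF \<iota>] comp_id_left[OF \<iota>] by simp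
  qed
  with \<iota> s show ?thesis by (auto simp: is_iso_def)
qed

lemma singleton_coproduct_ident:
  assumes "X i \<in> Obj C" and "\<iota> i = Ident C (X i)"
  shows "is_coproduct C {i} X (X i) \<iota>"
  by (rule is_coproductI) (use assms in \<open>auto simp: id_hom comp_id_right\<close>)

text \<open>
  Associativity of coproducts, with the partition of the index set \<open>K\<close> given by the fibres of \<open>\<pi>\<close>. If
  each block has coproduct \<open>X i\<close>, a cocone under the blocks carries the same data as a cocone under the
  whole family; so the direction from left to right cancels the inner coproducts, and the other one
  composes coproducts.
\<close>
lemma coproduct_group_iff:
  assumes inner: "\<And>i. i \<in> I \<Longrightarrow> is_coproduct C {k \<in> K. \<pi> k = i} W (X i) \<kappa>"
    and \<pi>: "\<And>k. k \<in> K \<Longrightarrow> \<pi> k \<in> I"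
    and Y: "Y \<in> Obj C" and \<iota>: "\<And>i. i \<in> I \<Longrightarrow> \<iota> i \<in> Hom C (X i) Y"
  shows "is_coproduct C K W Y (\<lambda>k. Comp C (\<iota> (\<pi> k)) (\<kappa> k)) \<longleftrightarrow> is_coproduct C I X Y \<iota>"
proof -
  have \<kappa>: "\<kappa> k \<in> Hom C (W k) (X (\<pi> k))" if "k \<in> K" for k
    using coproduct_inj[OF inner[OF \<pi>[OF that]], of k] that by simp
  have \<iota>\<kappa>: "\<iota> (\<pi> k) \<in> Hom C (X (\<pi> k)) Y" if "k \<in> K" for k using \<iota> \<pi> that by blast
  have inner_ext: "h = h'" if "i \<in> I" "h \<in> Hom C (X i) Z" "h' \<in> Hom C (X i) Z"
    "\<And>k. \<lbrakk>k \<in> K; \<pi> k = i\<rbrakk> \<Longrightarrow> Comp C h (\<kappa> k) = Comp C h' (\<kappa> k)" for i h h' Z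
    using coproduct_ext[OF inner[OF that(1)] that(2,3)] that(4) by blast
  have assoc: "Comp C h (Comp C (\<iota> (\<pi> k)) (\<kappa> k)) = Comp C (Comp C h (\<iota> (\<pi> k))) (\<kappa> k)"
    if "h \<in> Hom C Y Z" "k \<in> K" for h k Z
    using comp_assoc[OF \<kappa>[OF that(2)] \<iota>\<kappa>[OF that(2)] that(1)] .
  show ?thesis
  proof
    assume outer: "is_coproduct C K W Y (\<lambda>k. Comp C (\<iota> (\<pi> k)) (\<kappa> k))"
    show "is_coproduct C I X Y \<iota>"
    proof (rule is_coproductI[OF Y \<iota>])
      fix Z f assume Z: "Z \<in> Obj C" and f: "\<And>i. i \<in> I \<Longrightarrow> f i \<in> Hom C (X i) Z"
      obtain h where h: "h \<in> Hom C Y Z"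
        "\<And>k. k \<in> K \<Longrightarrow> Comp C h (Comp C (\<iota> (\<pi> k)) (\<kappa> k)) = Comp C (f (\<pi> k)) (\<kappa> k)"
        using coproduct_copair[OF outer Z, of "\<lambda>k. Comp C (f (\<pi> k)) (\<kappa> k)"] \<kappa> f \<pi> comp_hom
        by metis
      have "Comp C h (\<iota> i) = f i" if "i \<in> I" for i
        by (rule inner_ext[OF that comp_hom[OF \<iota>[OF that] h(1)] f[OF that]])
          (use assoc[OF h(1)] h(2) in auto)
      with h(1) show "\<exists>h\<in>Hom C Y Z. \<forall>i\<in>I. Comp C h (\<iota> i) = f i" by blast
    next
      fix Z h h' assume h: "h \<in> Hom C Y Z" and h': "h' \<in> Hom C Y Z"
        and eq: "\<And>i. i \<in> I \<Longrightarrow> Comp C h (\<iota> i) = Comp C h' (\<iota> i)"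
      show "h = h'"
        by (rule coproduct_ext[OF outer h h']) (simp add: assoc[OF h] assoc[OF h'] eq \<pi>)
    qed
  next
    assume outer: "is_coproduct C I X Y \<iota>"
    show "is_coproduct C K W Y (\<lambda>k. Comp C (\<iota> (\<pi> k)) (\<kappa> k))"
    proof (rule is_coproductI[OF Y comp_hom[OF \<kappa> \<iota>\<kappa>]])
      fix Z g assume Z: "Z \<in> Obj C" and g: "\<And>k. k \<in> K \<Longrightarrow> g k \<in> Hom C (W k) Z"
      have "\<exists>f. f \<in> Hom C (X i) Z \<and> (\<forall>k\<in>K. \<pi> k = i \<longrightarrow> Comp C f (\<kappa> k) = g k)" if "i \<in> I" for i
        using coproduct_copair[OF inner[OF that] Z, of g] g
        by (metis (mono_tags, lifting) mem_Collect_eq)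
      then obtain f where f: "\<And>i. i \<in> I \<Longrightarrow> f i \<in> Hom C (X i) Z"
        "\<And>k. k \<in> K \<Longrightarrow> Comp C (f (\<pi> k)) (\<kappa> k) = g k"
        using \<pi> by metis
      obtain h where h: "h \<in> Hom C Y Z" "\<And>i. i \<in> I \<Longrightarrow> Comp C h (\<iota> i) = f i"
        using coproduct_copair[OF outer Z f(1)] by metis
      then show "\<exists>h\<in>Hom C Y Z. \<forall>k\<in>K. Comp C h (Comp C (\<iota> (\<pi> k)) (\<kappa> k)) = g k"
        using assoc[OF h(1)] f(2) \<pi> by (intro bexI[of _ h]) auto
    next
      fix Z h h' assume h: "h \<in> Hom C Y Z" and h': "h' \<in> Hom C Y Z"
        and eq: "\<And>k. k \<in> K \<Longrightarrow>
          Comp C h (Comp C (\<iota> (\<pi> k)) (\<kappa> k)) = Comp C h' (Comp C (\<iota> (\<pi> k)) (\<kappa> k))"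
      show "h = h'"
      proof (rule coproduct_ext[OF outer h h'])
        fix i assume i: "i \<in> I"
        show "Comp C h (\<iota> i) = Comp C h' (\<iota> i)"
          by (rule inner_ext[OF i comp_hom[OF \<iota>[OF i] h] comp_hom[OF \<iota>[OF i] h']])
            (use assoc[OF h] assoc[OF h'] eq in auto)
      qed
    qed
  qed
qed

lemma finite_coproduct_ex:
  assumes bin: "has_binary_coproducts C"
    and "finite I" and "I \<noteq> {}" and "\<And>i. i \<in> I \<Longrightarrow> X i \<in> Obj C"
  shows "\<exists>Y \<iota>. is_coproduct C I X Y \<iota>"
  using assms(2-4)
proof (induction I rule: finite_ne_induct)
  case (singleton x)
  have "is_coproduct C {x} X (X x) (\<lambda>_. Ident C (X x))"
    by (rule singleton_coproduct_ident) (use singleton in auto)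
  then show ?case by blast
next
  case (insert x F)
  obtain Y0 \<iota>0 where Y0: "is_coproduct C F X Y0 \<iota>0" using insert by blast
  have "X x \<in> Obj C" "Y0 \<in> Obj C" using insert.prems Y0 by (auto simp: is_coproduct_def)
  then obtain Z j where Z: "is_coproduct C (UNIV :: bool set) (case_bool (X x) Y0) Z j"
    using bin unfolding has_binary_coproducts_def by blast
  \<comment> \<open>Group \<open>insert x F\<close> into the two blocks \<open>{x}\<close> and \<open>F\<close>, told apart by \<open>k = x\<close>.\<close>
  define \<kappa> where "\<kappa> = \<iota>0(x := Ident C (X x))"
  have "is_coproduct C {k \<in> insert x F. (k = x) = b} X (case_bool (X x) Y0 b) \<kappa>" for b
  proof (cases b)
    case True
    have "{k \<in> insert x F. (k = x) = b} = {x}" using True by auto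
    with True show ?thesis
      using singleton_coproduct_ident[of X x \<kappa>] \<open>X x \<in> Obj C\<close> by (simp add: \<kappa>_def)
  next
    case False
    have "{k \<in> insert x F. (k = x) = b} = F" using False insert.hyps by auto
    moreover have "is_coproduct C F X Y0 \<kappa>"
      using Y0 insert.hyps by (subst is_coproduct_cong[where I' = F and X' = X and \<iota>' = \<iota>0])
        (auto simp: \<kappa>_def)
    ultimately show ?thesis using False by simp
  qed
  from coproduct_group_iff[where \<pi> = "\<lambda>k. k = x" and I = UNIV and \<iota> = j, OF this]
  have "is_coproduct C (insert x F) X Z (\<lambda>k. Comp C (j (k = x)) (\<kappa> k))"
    using Z by (auto simp: is_coproduct_def)
  then show ?case by blast
qed

end


section \<open>Diagrams on a graph and on its in-splitting\<close>

lemma Obj_Diag_coprod: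
  "D \<in> Obj (Diag_coprod C G) \<longleftrightarrow> is_diagram C G D \<and> coproduct_condition C G D"
  by (simp add: Diag_coprod_def)

lemma Hom_Diag_coprod:
  "T \<in> Hom (Diag_coprod C G) D E \<longleftrightarrow> D \<in> Obj (Diag_coprod C G) \<and> E \<in> Obj (Diag_coprod C G) \<and>
    mor_dom T = D \<and> mor_cod T = E \<and> is_diagram_mor C G T"
  by (auto simp: Hom_def Diag_coprod_def Let_def)

lemma component_Comp:
  "component (Comp (Diag_coprod C G) U T) = (\<lambda>v\<in>verts G. Comp C (component U v) (component T v))"
  by (simp add: Diag_coprod_def Let_def)

lemma component_Ident:
  "component (Ident (Diag_coprod C G) D) = (\<lambda>v\<in>verts G. Ident C (at_vert D v))"
  by (simp add: Diag_coprod_def Let_def)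

lemma diagram_vert:
  "\<lbrakk>D \<in> Obj (Diag_coprod C G); v \<in> verts G\<rbrakk> \<Longrightarrow> at_vert D v \<in> Obj C"
  by (auto simp: Obj_Diag_coprod is_diagram_def)

lemma diagram_arc:
  "\<lbrakk>D \<in> Obj (Diag_coprod C G); e \<in> arcs G\<rbrakk>
    \<Longrightarrow> at_arc D e \<in> Hom C (at_vert D (tail G e)) (at_vert D (head G e))"
  by (auto simp: Obj_Diag_coprod is_diagram_def)

lemma diagram_coproduct:
  "\<lbrakk>D \<in> Obj (Diag_coprod C G); v \<in> verts G; \<not> is_source G v\<rbrakk>
    \<Longrightarrow> is_coproduct C (in_arcs G v) (\<lambda>e. at_vert D (tail G e)) (at_vert D v) (at_arc D)"
  by (simp add: Obj_Diag_coprod coproduct_condition_def)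

lemma component_hom:
  "\<lbrakk>T \<in> Hom (Diag_coprod C G) D E; v \<in> verts G\<rbrakk>
    \<Longrightarrow> component T v \<in> Hom C (at_vert D v) (at_vert E v)"
  by (auto simp: Hom_Diag_coprod is_diagram_mor_def)

lemma component_square:
  "\<lbrakk>T \<in> Hom (Diag_coprod C G) D E; e \<in> arcs G\<rbrakk>
    \<Longrightarrow> Comp C (component T (head G e)) (at_arc D e) = Comp C (at_arc E e) (component T (tail G e))"
  by (auto simp: Hom_Diag_coprod is_diagram_mor_def)

lemma diagram_mor_eqI:
  assumes "T \<in> Hom (Diag_coprod C G) D E" and "T' \<in> Hom (Diag_coprod C G) D E"
    and "\<And>v. v \<in> verts G \<Longrightarrow> component T v = component T' v"
  shows "T = T'"
proof (rule diagram_mor.equality)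
  have "component T \<in> extensional (verts G)" "component T' \<in> extensional (verts G)"
    using assms(1,2) by (auto simp: Hom_Diag_coprod is_diagram_mor_def PiE_def)
  then show "component T = component T'" by (rule extensionalityI) (rule assms(3))
qed (use assms(1,2) in \<open>auto simp: Hom_Diag_coprod\<close>)

lemma diagram_mor_of_components:
  assumes "D \<in> Obj (Diag_coprod C G)" and "E \<in> Obj (Diag_coprod C G)" and "wf_digraph G"
    and t: "\<And>v. v \<in> verts G \<Longrightarrow> t v \<in> Hom C (at_vert D v) (at_vert E v)"
    and sq: "\<And>e. e \<in> arcs G \<Longrightarrow>
      Comp C (t (head G e)) (at_arc D e) = Comp C (at_arc E e) (t (tail G e))"
  obtains T where "T \<in> Hom (Diag_coprod C G) D E" and "\<And>v. v \<in> verts G \<Longrightarrow> component T v = t v"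
proof -
  interpret wf_digraph G by fact
  show thesis
    by (rule that[of "\<lparr>mor_dom = D, mor_cod = E, component = restrict t (verts G)\<rparr>"])
      (use assms in \<open>auto simp: Hom_Diag_coprod is_diagram_mor_def\<close>)
qed

lemma diagram_of_families:
  assumes "wf_digraph G"
    and X: "\<And>v. v \<in> verts G \<Longrightarrow> X v \<in> Obj C"
    and a: "\<And>e. e \<in> arcs G \<Longrightarrow> a e \<in> Hom C (X (tail G e)) (X (head G e))"
    and cop: "\<And>v. \<lbrakk>v \<in> verts G; \<not> is_source G v\<rbrakk>
      \<Longrightarrow> is_coproduct C (in_arcs G v) (\<lambda>e. X (tail G e)) (X v) a"
  obtains D where "D \<in> Obj (Diag_coprod C G)" and "\<And>v. v \<in> verts G \<Longrightarrow> at_vert D v = X v"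
    and "\<And>e. e \<in> arcs G \<Longrightarrow> at_arc D e = a e"
proof -
  interpret wf_digraph G by fact
  define D where "D = \<lparr>at_vert = restrict X (verts G), at_arc = restrict a (arcs G)\<rparr>"
  have "coproduct_condition C G D"
    unfolding coproduct_condition_def
  proof (intro ballI impI)
    fix v assume v: "v \<in> verts G" "\<not> is_source G v"
    show "is_coproduct C (in_arcs G v) (\<lambda>e. at_vert D (tail G e)) (at_vert D v) (at_arc D)"
      using cop[OF v] v(1)
      by (subst is_coproduct_cong[where I' = "in_arcs G v" and X' = "\<lambda>e. X (tail G e)" and \<iota>' = a])
        (auto simp: D_def)
  qed
  moreover have "is_diagram C G D" using X a by (auto simp: is_diagram_def D_def)
  ultimately show thesis by (intro that[of D]) (auto simp: Obj_Diag_coprod D_def)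
qed

section \<open>Links between diagrams on a graph and on its in-splitting\<close>

locale in_splitting_data = wf_digraph G + category C
  for G :: "('v, 'e) pre_digraph" and C :: "('o, 'm) pre_category" +
  fixes p :: "'v + 'e \<Rightarrow> nat"
  assumes level_le: "e \<in> arcs G \<Longrightarrow> p (Inr e) \<le> p (Inl (head G e))"
    and source_zero: "\<lbrakk>v \<in> verts G; is_source G v\<rbrakk> \<Longrightarrow> p (Inl v) = 0"
    and level_surj: "\<lbrakk>v \<in> verts G; \<not> is_source G v\<rbrakk>
      \<Longrightarrow> (\<lambda>e. p (Inr e)) ` in_arcs G v = {0..p (Inl v)}"
begin

abbreviation S where "S \<equiv> in_splitting G p"

text \<open>
  The index set that is grouped in two ways: by arc, it refines the arcs into \<open>v\<close> in \<open>G\<close>, and by label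
  it is the disjoint union of the sets of arcs into the vertices \<open>(v, n)\<close> of the in-splitting.
\<close>
definition split_arcs :: "'v \<Rightarrow> ('e \<times> nat) set" where
  "split_arcs v = Sigma (in_arcs G v) (\<lambda>e. {..p (Inl (tail G e))})"

lemma wf_S: "wf_digraph S"
  using wf_digraph_in_splitting wf_digraph_axioms level_le .

lemma verts_S: "(v, n) \<in> verts S \<longleftrightarrow> v \<in> verts G \<and> n \<le> p (Inl v)"
  by (simp add: in_splitting_def)

lemma arcs_S: "(e, n) \<in> arcs S \<longleftrightarrow> e \<in> arcs G \<and> n \<le> p (Inl (tail G e))"
  by (simp add: in_splitting_def)

lemma tail_S: "tail S k = (tail G (fst k), snd k)"
  by (simp add: in_splitting_def split_beta)

lemma head_S: "head S k = (head G (fst k), p (Inr (fst k)))"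
  by (simp add: in_splitting_def split_beta)

lemma in_arcs_S: "in_arcs S (v, n) = {k \<in> split_arcs v. p (Inr (fst k)) = n}"
  by (auto simp: in_arcs_def head_S arcs_S split_arcs_def)

text \<open>
  Surjectivity of the labelling provides an arc into \<open>(v, n)\<close> for each level \<open>n\<close> of a vertex that is
  not a source.
\<close>
lemma is_source_S:
  assumes "v \<in> verts G" and "n \<le> p (Inl v)"
  shows "is_source S (v, n) \<longleftrightarrow> is_source G v"
proof
  assume S: "is_source S (v, n)"
  show "is_source G v"
  proof (rule ccontr)
    assume "\<not> is_source G v"
    from level_surj[OF assms(1) this] obtain e where "e \<in> in_arcs G v" "p (Inr e) = n"
      using assms(2) by (metis (no_types, lifting) atLeastAtMost_iff imageE le0)
    then have "(e, 0) \<in> in_arcs S (v, n)" by (simp add: in_arcs_S split_arcs_def)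
    with S show False by (simp add: is_source_def)
  qed
qed (auto simp: is_source_def in_arcs_S split_arcs_def)

definition level_coproduct where
  "level_coproduct X Y q v \<longleftrightarrow>
    is_coproduct C {..p (Inl v)} (\<lambda>n. X (v, n)) (Y v) (\<lambda>n. q (v, n))"

definition link ::
    "('v, 'e, 'o, 'm) diagram \<Rightarrow> ('v \<times> nat, 'e \<times> nat, 'o, 'm) diagram \<Rightarrow> ('v \<times> nat \<Rightarrow> 'm) \<Rightarrow> bool"
  where
  "link D D' q \<longleftrightarrow> D \<in> Obj (Diag_coprod C G) \<and> D' \<in> Obj (Diag_coprod C S) \<and>
    (\<forall>v\<in>verts G. level_coproduct (at_vert D') (at_vert D) q v) \<and>
    (\<forall>k\<in>arcs S. Comp C (at_arc D (fst k)) (q (tail S k)) = Comp C (q (head S k)) (at_arc D' k))"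

definition link_mor where
  "link_mor q r T T' \<longleftrightarrow>
    (\<forall>w\<in>verts S. Comp C (component T (fst w)) (q w) = Comp C (r w) (component T' w))"

text \<open>
  The copies of one arc \<open>e\<close> start at the levels of the source of \<open>e\<close>, so their sources have coproduct
  \<open>Y (tail G e)\<close>. This is the inner coproduct whenever \<open>split_arcs v\<close> is grouped by arcs.
\<close>
lemma coproduct_over_split_arcs:
  assumes "e \<in> in_arcs G v" and "level_coproduct X Y q (tail G e)"
  shows "is_coproduct C {k \<in> split_arcs v. fst k = e} (\<lambda>k. X (tail S k)) (Y (tail G e))
    (\<lambda>k. q (tail S k))"
proof -
  have "is_coproduct C (Pair e ` {..p (Inl (tail G e))}) (\<lambda>k. X (tail S k)) (Y (tail G e))
      (\<lambda>k. q (tail S k))"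
    using assms(2) by (intro is_coproduct_reindex) (auto simp: inj_on_def tail_S level_coproduct_def)
  moreover have "Pair e ` {..p (Inl (tail G e))} = {k \<in> split_arcs v. fst k = e}"
    using assms(1) by (auto simp: split_arcs_def)
  ultimately show ?thesis by simp
qed

lemma level_coproduct_inj:
  "\<lbrakk>level_coproduct X Y q v; n \<le> p (Inl v)\<rbrakk> \<Longrightarrow> q (v, n) \<in> Hom C (X (v, n)) (Y v)"
  unfolding level_coproduct_def by (drule coproduct_inj[where i = n]) auto

lemma arc_levels:
  assumes "e \<in> arcs G" and "n \<le> p (Inl (tail G e))"
  shows "(e, n) \<in> arcs S" and "(tail G e, n) \<in> verts S" and "(head G e, p (Inr e)) \<in> verts S"
  using assms level_le by (auto simp: arcs_S verts_S)

lemma level_of_split_arc: "k \<in> split_arcs v \<Longrightarrow> p (Inr (fst k)) \<le> p (Inl v)"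
  using level_le by (auto simp: split_arcs_def)

section \<open>Existence of linked diagrams\<close>

text \<open>
  \<open>D\<close> has the coproduct of the levels \<open>D'\<^sub>v\<^sub>,\<^sub>n\<close> at \<open>v\<close>. Composing this coproduct with those of \<open>D'\<close> presents it
  as a coproduct over \<open>split_arcs v\<close>; cancelling the coproducts at the tails leaves the coproduct
  over the arcs into \<open>v\<close>.
\<close>
lemma merge_ex:
  assumes bin: "has_binary_coproducts C" and D': "D' \<in> Obj (Diag_coprod C S)"
  shows "\<exists>D q. link D D' q"
proof -
  have "\<exists>Y \<iota>. is_coproduct C {..p (Inl v)} (\<lambda>n. at_vert D' (v, n)) Y \<iota>" if "v \<in> verts G" for v
    by (rule finite_coproduct_ex[OF bin]) (use that diagram_vert[OF D'] in \<open>auto simp: verts_S\<close>)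
  then obtain Y \<iota> where
    "\<And>v. v \<in> verts G \<Longrightarrow> is_coproduct C {..p (Inl v)} (\<lambda>n. at_vert D' (v, n)) (Y v) (\<iota> v)"
    by metis
  moreover define q where "q = (\<lambda>(v, n). \<iota> v n)"
  ultimately have q: "level_coproduct (at_vert D') Y q v" if "v \<in> verts G" for v
    using that by (simp add: level_coproduct_def)
  have Y: "Y v \<in> Obj C" if "v \<in> verts G" for v
    using q[OF that] by (simp add: level_coproduct_def is_coproduct_def)
  have D'_arc: "at_arc D' (e, n) \<in> Hom C (at_vert D' (tail G e, n)) (at_vert D' (head G e, p (Inr e)))"
    if "e \<in> arcs G" "n \<le> p (Inl (tail G e))" for e n
    using diagram_arc[OF D' arc_levels(1)[OF that]] by (simp add: tail_S head_S)
  have "\<exists>a. a \<in> Hom C (Y (tail G e)) (Y (head G e)) \<and> (\<forall>n\<le>p (Inl (tail G e)).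
      Comp C a (q (tail G e, n)) = Comp C (q (head G e, p (Inr e))) (at_arc D' (e, n)))"
    if e: "e \<in> arcs G" for e
  proof -
    have t: "tail G e \<in> verts G" and h: "head G e \<in> verts G" using e by auto
    show ?thesis
      by (rule coproduct_copair[OF q[OF t, unfolded level_coproduct_def] Y[OF h],
            of "\<lambda>n. Comp C (q (head G e, p (Inr e))) (at_arc D' (e, n))"])
        (use comp_hom[OF D'_arc[OF e] level_coproduct_inj[OF q[OF h] level_le[OF e]]] in auto)
  qed
  then obtain a where a: "\<And>e. e \<in> arcs G \<Longrightarrow> a e \<in> Hom C (Y (tail G e)) (Y (head G e))"
    and a_sq: "\<And>e n. \<lbrakk>e \<in> arcs G; n \<le> p (Inl (tail G e))\<rbrakk> \<Longrightarrow>
      Comp C (a e) (q (tail G e, n)) = Comp C (q (head G e, p (Inr e))) (at_arc D' (e, n))"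
    by metis
  have cop: "is_coproduct C (in_arcs G v) (\<lambda>e. Y (tail G e)) (Y v) a"
    if v: "v \<in> verts G" "\<not> is_source G v" for v
  proof -
    have "is_coproduct C {k \<in> split_arcs v. p (Inr (fst k)) = n} (\<lambda>k. at_vert D' (tail S k))
        (at_vert D' (v, n)) (at_arc D')" if "n \<in> {..p (Inl v)}" for n
      using diagram_coproduct[OF D', of "(v, n)"] is_source_S[of v n] v that
      by (simp add: in_arcs_S verts_S)
    then have "is_coproduct C (split_arcs v) (\<lambda>k. at_vert D' (tail S k)) (Y v)
        (\<lambda>k. Comp C (q (v, p (Inr (fst k)))) (at_arc D' k)) \<longleftrightarrow>
        level_coproduct (at_vert D') Y q v"
      unfolding level_coproduct_def
      by (rule coproduct_group_iff[where \<pi> = "\<lambda>k. p (Inr (fst k))" and \<iota> = "\<lambda>n. q (v, n)"])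
        (use level_of_split_arc Y[OF v(1)] level_coproduct_inj[OF q[OF v(1)]] in auto)
    then have "is_coproduct C (split_arcs v) (\<lambda>k. at_vert D' (tail S k)) (Y v)
        (\<lambda>k. Comp C (q (v, p (Inr (fst k)))) (at_arc D' k))"
      using q[OF v(1)] by simp
    moreover have "Comp C (a (fst k)) (q (tail S k)) = Comp C (q (v, p (Inr (fst k)))) (at_arc D' k)"
      if "k \<in> split_arcs v" for k
      using that a_sq[of "fst k" "snd k"] by (auto simp: split_arcs_def tail_S)
    ultimately have "is_coproduct C (split_arcs v) (\<lambda>k. at_vert D' (tail S k)) (Y v)
        (\<lambda>k. Comp C (a (fst k)) (q (tail S k)))"
      by (simp cong: is_coproduct_cong)
    moreover have "is_coproduct C (split_arcs v) (\<lambda>k. at_vert D' (tail S k)) (Y v)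
        (\<lambda>k. Comp C (a (fst k)) (q (tail S k))) \<longleftrightarrow> ?thesis"
    proof (rule coproduct_group_iff[where \<pi> = fst])
      show "is_coproduct C {k \<in> split_arcs v. fst k = e} (\<lambda>k. at_vert D' (tail S k))
          (Y (tail G e)) (\<lambda>k. q (tail S k))" if "e \<in> in_arcs G v" for e
        using coproduct_over_split_arcs[OF that q] that by auto
    qed (use a Y[OF v(1)] in \<open>auto simp: split_arcs_def\<close>)
    ultimately show ?thesis by simp
  qed
  from diagram_of_families[OF wf_digraph_axioms Y a cop] obtain D
    where D: "D \<in> Obj (Diag_coprod C G)" "\<And>v. v \<in> verts G \<Longrightarrow> at_vert D v = Y v"
      "\<And>e. e \<in> arcs G \<Longrightarrow> at_arc D e = a e"
    by metis
  have "link D D' q"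
    using D D' q a_sq by (auto simp: link_def level_coproduct_def tail_S head_S arcs_S)
  then show ?thesis by blast
qed

text \<open>
  At a vertex that is not a source, \<open>D'\<^sub>v\<^sub>,\<^sub>n\<close> is a coproduct of the \<open>D\<close> at the tails of the arcs into \<open>v\<close> with
  label \<open>n\<close>, with injections \<open>i\<^sub>e\<close>; at a source it is \<open>D\<^sub>v\<close>. The link \<open>q\<close> is induced by the arcs of \<open>D\<close>,
  so that \<open>D\<^sub>e = q \<circ> i\<^sub>e\<close>, and the arcs of \<open>D'\<close> are \<open>i\<^sub>e \<circ> q\<close>.
  Cancelling in the coproduct condition for \<open>D\<close> shows that \<open>q\<close> is a link; composing the coproduct
  \<open>D'\<^sub>v\<^sub>,\<^sub>n\<close> with the coproducts \<open>q\<close> at the tails gives the coproduct condition for \<open>D'\<close>.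
\<close>
lemma split_ex:
  assumes bin: "has_binary_coproducts C" and fin: "\<And>v. v \<in> verts G \<Longrightarrow> finite (in_arcs G v)"
    and D: "D \<in> Obj (Diag_coprod C G)"
  shows "\<exists>D' q. link D D' q"
proof -
  define J where "J v n = {e \<in> in_arcs G v. p (Inr e) = n}" for v n
  have "\<exists>Y \<iota>. if is_source G v then Y = at_vert D v
      else is_coproduct C (J v n) (\<lambda>e. at_vert D (tail G e)) Y \<iota>"
    if "v \<in> verts G" "n \<le> p (Inl v)" for v n
  proof (cases "is_source G v")
    case False
    have "n \<in> (\<lambda>e. p (Inr e)) ` in_arcs G v" using level_surj[OF that(1) False] that(2) by simp
    then have "J v n \<noteq> {}" by (auto simp: J_def)
    moreover have "finite (J v n)" unfolding J_def by (rule finite_subset[OF _ fin[OF that(1)]]) blast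
    moreover have "at_vert D (tail G e) \<in> Obj C" if "e \<in> J v n" for e
      using that diagram_vert[OF D, of "tail G e"] by (auto simp: J_def)
    ultimately have "\<exists>Y \<iota>. is_coproduct C (J v n) (\<lambda>e. at_vert D (tail G e)) Y \<iota>"
      by (intro finite_coproduct_ex[OF bin])
    with False show ?thesis by simp
  qed auto
  then obtain X \<iota> where X\<iota>: "\<And>v n. \<lbrakk>v \<in> verts G; n \<le> p (Inl v)\<rbrakk> \<Longrightarrow>
      if is_source G v then X v n = at_vert D v
      else is_coproduct C (J v n) (\<lambda>e. at_vert D (tail G e)) (X v n) (\<iota> v n)"
    by metis
  \<comment> \<open>The head and the label of \<open>e\<close> determine the one block to which \<open>e\<close> belongs.\<close>
  define i where "i e = \<iota> (head G e) (p (Inr e)) e" for e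
  have X_source: "X v n = at_vert D v" if "v \<in> verts G" "n \<le> p (Inl v)" "is_source G v" for v n
    using X\<iota>[OF that(1,2)] that(3) by simp
  have X_cop: "is_coproduct C (J v n) (\<lambda>e. at_vert D (tail G e)) (X v n) i"
    if "v \<in> verts G" "n \<le> p (Inl v)" "\<not> is_source G v" for v n
    using X\<iota>[OF that(1,2)] that(3)
    by (subst is_coproduct_cong[where I' = "J v n" and X' = "\<lambda>e. at_vert D (tail G e)" and \<iota>' = "\<iota> v n"])
      (auto simp: i_def J_def)
  have X: "X v n \<in> Obj C" if "v \<in> verts G" "n \<le> p (Inl v)" for v n
    using X_source[OF that] X_cop[OF that, THEN coproduct_obj] diagram_vert[OF D that(1)]
    by (cases "is_source G v") simp_all
  have D_arc: "at_arc D e \<in> Hom C (at_vert D (tail G e)) (at_vert D v)" if "e \<in> in_arcs G v" for e v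
    using diagram_arc[OF D, of e] that by auto
  have "\<exists>q. q \<in> Hom C (X v n) (at_vert D v) \<and> (is_source G v \<longrightarrow> q = Ident C (at_vert D v)) \<and>
      (\<forall>e\<in>J v n. Comp C q (i e) = at_arc D e)" if v: "v \<in> verts G" "n \<le> p (Inl v)" for v n
  proof (cases "is_source G v")
    case True
    then show ?thesis
      using X_source[OF v] id_hom[OF diagram_vert[OF D v(1)]] by (auto simp: J_def is_source_def)
  next
    case False
    show ?thesis
      by (rule coproduct_copair[OF X_cop[OF v False] diagram_vert[OF D v(1)], of "at_arc D"])
        (use D_arc False in \<open>auto simp: J_def\<close>)
  qed
  then obtain q' where q': "\<And>v n. \<lbrakk>v \<in> verts G; n \<le> p (Inl v)\<rbrakk> \<Longrightarrow>
      q' v n \<in> Hom C (X v n) (at_vert D v) \<and> (is_source G v \<longrightarrow> q' v n = Ident C (at_vert D v)) \<and>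
      (\<forall>e\<in>J v n. Comp C (q' v n) (i e) = at_arc D e)"
    by metis
  define q where "q = (\<lambda>(v, n). q' v n)"
  define W where "W = (\<lambda>(v, n). X v n)"
  have qi: "Comp C (q (head G e, p (Inr e))) (i e) = at_arc D e" if "e \<in> arcs G" for e
    using q'[of "head G e" "p (Inr e)"] level_le[OF that] that by (auto simp: q_def J_def)
  have q: "level_coproduct W (at_vert D) q v" if v: "v \<in> verts G" for v
  proof (cases "is_source G v")
    case True
    then have "{..p (Inl v)} = {0}" using source_zero[OF v] by auto
    moreover have "is_coproduct C {0} (\<lambda>n. X v n) (X v 0) (\<lambda>n. q' v n)"
      by (rule singleton_coproduct_ident) (use X[OF v] q'[OF v] X_source[OF v] True in auto)
    ultimately show ?thesis
      using X_source[OF v _ True] by (simp add: level_coproduct_def W_def q_def)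
  next
    case False
    have "is_coproduct C {e \<in> in_arcs G v. p (Inr e) = n} (\<lambda>e. at_vert D (tail G e)) (X v n) i"
      if "n \<in> {..p (Inl v)}" for n
      using X_cop[OF v _ False] that by (simp add: J_def)
    then have "is_coproduct C (in_arcs G v) (\<lambda>e. at_vert D (tail G e)) (at_vert D v)
        (\<lambda>e. Comp C (q' v (p (Inr e))) (i e)) \<longleftrightarrow>
        is_coproduct C {..p (Inl v)} (X v) (at_vert D v) (q' v)"
      by (rule coproduct_group_iff[where \<pi> = "\<lambda>e. p (Inr e)"])
        (use q'[OF v] diagram_vert[OF D v] level_le in auto)
    moreover have "is_coproduct C (in_arcs G v) (\<lambda>e. at_vert D (tail G e)) (at_vert D v)
        (\<lambda>e. Comp C (q' v (p (Inr e))) (i e))"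
      using diagram_coproduct[OF D v False] qi
      by (subst is_coproduct_cong[where I' = "in_arcs G v" and X' = "\<lambda>e. at_vert D (tail G e)"
            and \<iota>' = "at_arc D"]) (auto simp: q_def)
    ultimately show ?thesis by (simp add: level_coproduct_def W_def q_def)
  qed
  have i: "i e \<in> Hom C (at_vert D (tail G e)) (X (head G e) (p (Inr e)))" if e: "e \<in> arcs G" for e
  proof -
    have "e \<in> J (head G e) (p (Inr e))" "\<not> is_source G (head G e)"
      using e by (auto simp: J_def is_source_def in_arcs_def)
    then show ?thesis
      using coproduct_inj[OF X_cop[of "head G e" "p (Inr e)"]] e level_le[OF e] by auto
  qed
  have cop: "is_coproduct C (in_arcs S w) (\<lambda>k. W (tail S k)) (W w)
      (\<lambda>k. Comp C (i (fst k)) (q (tail S k)))"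
    if w: "w \<in> verts S" "\<not> is_source S w" for w
  proof -
    obtain v n where vn: "w = (v, n)" by (cases w)
    have v: "v \<in> verts G" "n \<le> p (Inl v)" using w(1) by (auto simp: vn verts_S)
    have ns: "\<not> is_source G v" using w(2) is_source_S[OF v] by (simp add: vn)
    have "is_coproduct C (in_arcs S w) (\<lambda>k. W (tail S k)) (W w)
        (\<lambda>k. Comp C (i (fst k)) (q (tail S k))) \<longleftrightarrow>
        is_coproduct C (J v n) (\<lambda>e. at_vert D (tail G e)) (W w) i"
    proof (rule coproduct_group_iff[where \<pi> = fst])
      fix e assume e: "e \<in> J v n"
      have "{k \<in> in_arcs S w. fst k = e} = {k \<in> split_arcs v. fst k = e}"
        using e by (auto simp: vn in_arcs_S J_def)
      then show "is_coproduct C {k \<in> in_arcs S w. fst k = e} (\<lambda>k. W (tail S k))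
          (at_vert D (tail G e)) (\<lambda>k. q (tail S k))"
        using coproduct_over_split_arcs[OF _ q, of e v] e by (auto simp: J_def)
      show "i e \<in> Hom C (at_vert D (tail G e)) (W w)"
        using coproduct_inj[OF X_cop[OF v ns] e] by (simp add: vn W_def)
    qed (use X[OF v] in \<open>auto simp: vn in_arcs_S W_def J_def split_arcs_def\<close>)
    then show ?thesis using X_cop[OF v ns] by (simp add: vn W_def)
  qed
  obtain D' where D': "D' \<in> Obj (Diag_coprod C S)" "\<And>w. w \<in> verts S \<Longrightarrow> at_vert D' w = W w"
    "\<And>k. k \<in> arcs S \<Longrightarrow> at_arc D' k = Comp C (i (fst k)) (q (tail S k))"
  proof (rule diagram_of_families[OF wf_S _ _ cop])
    show "W w \<in> Obj C" if "w \<in> verts S" for w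
      using that X by (cases w) (auto simp: W_def verts_S)
    show "Comp C (i (fst k)) (q (tail S k)) \<in> Hom C (W (tail S k)) (W (head S k))"
      if "k \<in> arcs S" for k
      using that comp_hom[OF level_coproduct_inj[OF q[of "tail G (fst k)"], of "snd k"] i[of "fst k"]]
      by (cases k) (simp add: tail_S head_S arcs_S W_def)
  qed blast+
  have "Comp C (at_arc D (fst k)) (q (tail S k)) = Comp C (q (head S k)) (at_arc D' k)"
    if k: "k \<in> arcs S" for k
  proof -
    obtain e n where en: "k = (e, n)" by (cases k)
    have e: "e \<in> arcs G" "n \<le> p (Inl (tail G e))" using k by (auto simp: en arcs_S)
    have "q (tail G e, n) \<in> Hom C (W (tail G e, n)) (at_vert D (tail G e))"
      "q (head G e, p (Inr e)) \<in> Hom C (X (head G e) (p (Inr e))) (at_vert D (head G e))"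
      using level_coproduct_inj[OF q] e level_le by (auto simp: W_def)
    from comp_assoc[OF this(1) i[OF e(1)] this(2)] show ?thesis
      using qi[OF e(1)] D'(3)[OF k] by (simp add: en tail_S head_S)
  qed
  moreover have "level_coproduct (at_vert D') (at_vert D) q v" if v: "v \<in> verts G" for v
    using q[OF v] D'(2) v unfolding level_coproduct_def
    by (subst is_coproduct_cong[where I' = "{..p (Inl v)}" and X' = "\<lambda>n. W (v, n)"
          and \<iota>' = "\<lambda>n. q (v, n)"]) (auto simp: verts_S)
  ultimately have "link D D' q" using D D'(1) by (simp add: link_def)
  then show ?thesis by blast
qed

lemma linkD:
  assumes "link D D' q"
  shows "D \<in> Obj (Diag_coprod C G)" and "D' \<in> Obj (Diag_coprod C S)"
    and "\<And>v. v \<in> verts G \<Longrightarrow> is_coproduct C {..p (Inl v)} (\<lambda>n. at_vert D' (v, n)) (at_vert D v) (\<lambda>n. q (v, n))"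
    and "\<And>v n. \<lbrakk>v \<in> verts G; n \<le> p (Inl v)\<rbrakk> \<Longrightarrow> q (v, n) \<in> Hom C (at_vert D' (v, n)) (at_vert D v)"
    and "\<And>e n. \<lbrakk>e \<in> arcs G; n \<le> p (Inl (tail G e))\<rbrakk> \<Longrightarrow>
      Comp C (at_arc D e) (q (tail G e, n)) = Comp C (q (head G e, p (Inr e))) (at_arc D' (e, n))"
    and "\<And>e n. \<lbrakk>e \<in> arcs G; n \<le> p (Inl (tail G e))\<rbrakk> \<Longrightarrow>
      at_arc D' (e, n) \<in> Hom C (at_vert D' (tail G e, n)) (at_vert D' (head G e, p (Inr e)))"
  using assms level_coproduct_inj diagram_arc[of D' C S] arc_levels(1)
  unfolding link_def
  by (fastforce simp: level_coproduct_def tail_S head_S)+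

section \<open>Correspondence of morphisms\<close>

text \<open>
  \<open>T\<^sub>v\<close> is the map out of the coproduct \<open>D\<^sub>v\<close> prescribed by \<open>r \<circ> T'\<close>. The naturality square of \<open>T\<close> at \<open>e\<close>
  can be checked after composition with the injections \<open>q\<close> at the tail of \<open>e\<close>, where it becomes that
  of \<open>T'\<close>.
\<close>
lemma merge_mor_ex1:
  assumes q: "link D D' q" and r: "link E E' r" and T': "T' \<in> Hom (Diag_coprod C S) D' E'"
  shows "\<exists>!T. T \<in> Hom (Diag_coprod C G) D E \<and> link_mor q r T T'"
proof -
  note qD = linkD[OF q] and rE = linkD[OF r]
  have T'h: "component T' (v, n) \<in> Hom C (at_vert D' (v, n)) (at_vert E' (v, n))"
    if "v \<in> verts G" "n \<le> p (Inl v)" for v n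
    using component_hom[OF T'] that by (simp add: verts_S)
  have "\<exists>t. t \<in> Hom C (at_vert D v) (at_vert E v) \<and> (\<forall>n\<le>p (Inl v).
      Comp C t (q (v, n)) = Comp C (r (v, n)) (component T' (v, n)))" if v: "v \<in> verts G" for v
    by (rule coproduct_copair[OF qD(3)[OF v] diagram_vert[OF rE(1) v],
          of "\<lambda>n. Comp C (r (v, n)) (component T' (v, n))"])
      (use comp_hom[OF T'h[OF v] rE(4)[OF v]] in auto)
  then obtain t where t: "\<And>v. v \<in> verts G \<Longrightarrow> t v \<in> Hom C (at_vert D v) (at_vert E v)"
    "\<And>v n. \<lbrakk>v \<in> verts G; n \<le> p (Inl v)\<rbrakk> \<Longrightarrow>
      Comp C (t v) (q (v, n)) = Comp C (r (v, n)) (component T' (v, n))"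
    by metis
  obtain T where T: "T \<in> Hom (Diag_coprod C G) D E" "\<And>v. v \<in> verts G \<Longrightarrow> component T v = t v"
  proof (rule diagram_mor_of_components[OF qD(1) rE(1) wf_digraph_axioms t(1)])
    fix e assume e: "e \<in> arcs G"
    have tl: "tail G e \<in> verts G" and hd: "head G e \<in> verts G" using e by auto
    note De = diagram_arc[OF qD(1) e] and Ee = diagram_arc[OF rE(1) e]
    show "Comp C (t (head G e)) (at_arc D e) = Comp C (at_arc E e) (t (tail G e))"
    proof (rule coproduct_ext[OF qD(3)[OF tl] comp_hom[OF De t(1)[OF hd]] comp_hom[OF t(1)[OF tl] Ee]])
      fix n assume "n \<in> {..p (Inl (tail G e))}"
      then have n: "n \<le> p (Inl (tail G e))" by simp
      note qt = qD(4)[OF tl n] and rt = rE(4)[OF tl n] and qh = qD(4)[OF hd level_le[OF e]]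
        and rh = rE(4)[OF hd level_le[OF e]] and D'e = qD(6)[OF e n] and E'e = rE(6)[OF e n]
        and T't = T'h[OF tl n] and T'h' = T'h[OF hd level_le[OF e]]
      have "Comp C (Comp C (t (head G e)) (at_arc D e)) (q (tail G e, n))
          = Comp C (Comp C (t (head G e)) (q (head G e, p (Inr e)))) (at_arc D' (e, n))"
        using comp_assoc[OF qt De t(1)[OF hd]] comp_assoc[OF D'e qh t(1)[OF hd]] qD(5)[OF e n]
        by simp
      also have "\<dots> = Comp C (r (head G e, p (Inr e)))
          (Comp C (component T' (head G e, p (Inr e))) (at_arc D' (e, n)))"
        using t(2)[OF hd level_le[OF e]] comp_assoc[OF D'e T'h' rh] by simp
      also have "\<dots> = Comp C (r (head G e, p (Inr e)))
          (Comp C (at_arc E' (e, n)) (component T' (tail G e, n)))"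
        using component_square[OF T' arc_levels(1)[OF e n]] by (simp add: tail_S head_S)
      also have "\<dots> = Comp C (at_arc E e) (Comp C (r (tail G e, n)) (component T' (tail G e, n)))"
        using comp_assoc[OF T't E'e rh] comp_assoc[OF T't rt Ee] rE(5)[OF e n] by simp
      also have "\<dots> = Comp C (Comp C (at_arc E e) (t (tail G e))) (q (tail G e, n))"
        using t(2)[OF tl n] comp_assoc[OF qt t(1)[OF tl] Ee] by simp
      finally show "Comp C (Comp C (t (head G e)) (at_arc D e)) (q (tail G e, n)) =
          Comp C (Comp C (at_arc E e) (t (tail G e))) (q (tail G e, n))" .
    qed
  qed blast+
  show ?thesis
  proof (rule ex1I)
    show "T \<in> Hom (Diag_coprod C G) D E \<and> link_mor q r T T'"
      using T t(2) by (auto simp: link_mor_def verts_S)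
    fix U assume U: "U \<in> Hom (Diag_coprod C G) D E \<and> link_mor q r U T'"
    show "U = T"
    proof (rule diagram_mor_eqI[of _ _ _ D E])
      fix v assume v: "v \<in> verts G"
      show "component U v = component T v"
      proof (rule coproduct_ext[OF qD(3)[OF v], where Z = "at_vert E v"])
        show "Comp C (component U v) (q (v, n)) = Comp C (component T v) (q (v, n))"
          if "n \<in> {..p (Inl v)}" for n
          using U[unfolded link_mor_def, THEN conjunct2, rule_format, of "(v, n)"] t(2)[of v n]
            T(2)[OF v] that v by (simp add: verts_S)
      qed (use component_hom[OF conjunct1[OF U] v] component_hom[OF T(1) v] in simp_all)
    qed (use U T(1) in simp_all)
  qed
qed

text \<open>
  \<open>T'\<close> cannot be obtained by cancelling \<open>r\<close>, which need not be monic. Instead, the composites of \<open>T'\<close>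
  with the arcs of \<open>D'\<close> are forced to be certain maps \<open>b\<close> built from \<open>T\<close>, and away from sources these arcs
  form a coproduct.
\<close>
lemma split_mor_ex1:
  assumes q: "link D D' q" and r: "link E E' r" and T: "T \<in> Hom (Diag_coprod C G) D E"
  shows "\<exists>!T'. T' \<in> Hom (Diag_coprod C S) D' E' \<and> link_mor q r T T'"
proof -
  note qD = linkD[OF q] and rE = linkD[OF r]
  have "\<exists>a. a \<in> Hom C (at_vert E (tail G e)) (at_vert E' (head G e, p (Inr e))) \<and>
      (\<forall>n\<le>p (Inl (tail G e)). Comp C a (r (tail G e, n)) = at_arc E' (e, n))"
    if e: "e \<in> arcs G" for e
  proof -
    have tl: "tail G e \<in> verts G" using e by auto
    show ?thesis
      by (rule coproduct_copair[OF rE(3)[OF tl] diagram_vert[OF rE(2) arc_levels(3)[OF e le0]],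
            of "\<lambda>n. at_arc E' (e, n)"])
        (use rE(6)[OF e] in auto)
  qed
  then obtain a where a: "\<And>e. e \<in> arcs G \<Longrightarrow>
      a e \<in> Hom C (at_vert E (tail G e)) (at_vert E' (head G e, p (Inr e)))"
    "\<And>e n. \<lbrakk>e \<in> arcs G; n \<le> p (Inl (tail G e))\<rbrakk> \<Longrightarrow> Comp C (a e) (r (tail G e, n)) = at_arc E' (e, n)"
    by metis
  \<comment> \<open>\<open>a e\<close> factors the arc \<open>e\<close> of \<open>E\<close> through the level of \<open>E\<close> at its head that \<open>e\<close> belongs to.\<close>
  have ra: "Comp C (r (head G e, p (Inr e))) (a e) = at_arc E e" if e: "e \<in> arcs G" for e
  proof -
    have tl: "tail G e \<in> verts G" and hd: "head G e \<in> verts G" using e by auto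
    note rh = rE(4)[OF hd level_le[OF e]]
    show ?thesis
    proof (rule coproduct_ext[OF rE(3)[OF tl] comp_hom[OF a(1)[OF e] rh] diagram_arc[OF rE(1) e]])
      fix n assume "n \<in> {..p (Inl (tail G e))}"
      then have n: "n \<le> p (Inl (tail G e))" by simp
      show "Comp C (Comp C (r (head G e, p (Inr e))) (a e)) (r (tail G e, n)) =
          Comp C (at_arc E e) (r (tail G e, n))"
        using comp_assoc[OF rE(4)[OF tl n] a(1)[OF e] rh] a(2)[OF e n] rE(5)[OF e n] by simp
    qed
  qed
  define b where "b = (\<lambda>(e, n). Comp C (a e) (Comp C (component T (tail G e)) (q (tail G e, n))))"
  have b: "b (e, n) \<in> Hom C (at_vert D' (tail G e, n)) (at_vert E' (head G e, p (Inr e)))"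
    if e: "e \<in> arcs G" "n \<le> p (Inl (tail G e))" for e n
    unfolding b_def using comp_hom[OF comp_hom[OF qD(4)[OF _ e(2)] component_hom[OF T]] a(1)[OF e(1)]] e
    by auto
  have cop: "is_coproduct C (in_arcs S (v, n)) (\<lambda>k. at_vert D' (tail S k)) (at_vert D' (v, n)) (at_arc D')"
    if "v \<in> verts G" "n \<le> p (Inl v)" "\<not> is_source G v" for v n
    using diagram_coproduct[OF qD(2), of "(v, n)"] is_source_S[OF that(1,2)] that
    by (simp add: verts_S)
  have r_iso: "is_iso C (at_vert E' (v, n)) (at_vert E v) (r (v, n))"
    if v: "v \<in> verts G" "n \<le> p (Inl v)" "is_source G v" for v n
  proof -
    have "{..p (Inl v)} = {n}" using v source_zero[OF v(1,3)] by auto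
    then show ?thesis using rE(3)[OF v(1)] singleton_coproduct_iso by fastforce
  qed
  have b_forced: "Comp C u (at_arc D' (e, n)) = b (e, n)"
    if U: "U \<in> Hom (Diag_coprod C S) D' E'" "link_mor q r T U" and e: "e \<in> arcs G" "n \<le> p (Inl (tail G e))"
      and u: "u = component U (head G e, p (Inr e))" for U u e n
  proof -
    have tl: "tail G e \<in> verts G" using e by auto
    have Ut: "component U (tail G e, n) \<in> Hom C (at_vert D' (tail G e, n)) (at_vert E' (tail G e, n))"
      using component_hom[OF U(1) arc_levels(2)[OF e]] .
    have "Comp C u (at_arc D' (e, n)) = Comp C (at_arc E' (e, n)) (component U (tail G e, n))"
      using component_square[OF U(1) arc_levels(1)[OF e]] u by (simp add: tail_S head_S)
    also have "\<dots> = Comp C (a e) (Comp C (r (tail G e, n)) (component U (tail G e, n)))"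
      using comp_assoc[OF Ut rE(4)[OF tl e(2)] a(1)[OF e(1)]] a(2)[OF e] by simp
    also have "\<dots> = b (e, n)"
      using U(2) arc_levels(2)[OF e] by (auto simp: link_mor_def b_def)
    finally show ?thesis .
  qed
  \<comment> \<open>At a source the last conjunct is void and \<open>t\<close> comes from inverting \<open>r\<close>; elsewhere the last
    conjunct determines \<open>t\<close> and implies the second one.\<close>
  have "\<exists>t. t \<in> Hom C (at_vert D' (v, n)) (at_vert E' (v, n)) \<and>
      Comp C (component T v) (q (v, n)) = Comp C (r (v, n)) t \<and>
      (\<forall>k\<in>in_arcs S (v, n). Comp C t (at_arc D' k) = b k)"
    if v: "v \<in> verts G" "n \<le> p (Inl v)" for v n
  proof (cases "is_source G v")
    case True
    obtain s where s: "s \<in> Hom C (at_vert E v) (at_vert E' (v, n))"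
      "Comp C (r (v, n)) s = Ident C (at_vert E v)"
      using r_iso[OF v True] by (auto simp: is_iso_def)
    note Tq = comp_hom[OF qD(4)[OF v] component_hom[OF T v(1)]]
    have "Comp C (r (v, n)) (Comp C s (Comp C (component T v) (q (v, n)))) =
        Comp C (component T v) (q (v, n))"
      using comp_assoc[OF Tq s(1) rE(4)[OF v]] s(2) comp_id_left[OF Tq] by simp
    then show ?thesis
      using comp_hom[OF Tq s(1)] is_source_S[OF v] True by (auto simp: is_source_def)
  next
    case False
    have bk: "b k \<in> Hom C (at_vert D' (tail S k)) (at_vert E' (v, n))" if "k \<in> in_arcs S (v, n)" for k
      using that b by (cases k) (auto simp: in_arcs_S split_arcs_def tail_S)
    obtain t where t: "t \<in> Hom C (at_vert D' (v, n)) (at_vert E' (v, n))"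
      "\<And>k. k \<in> in_arcs S (v, n) \<Longrightarrow> Comp C t (at_arc D' k) = b k"
      using coproduct_copair[OF cop[OF v False] diagram_vert[OF rE(2)] bk] v by (auto simp: verts_S)
    note Tv = component_hom[OF T v(1)]
    have "Comp C (component T v) (q (v, n)) = Comp C (r (v, n)) t"
    proof (rule coproduct_ext[OF cop[OF v False] comp_hom[OF qD(4)[OF v] Tv] comp_hom[OF t(1) rE(4)[OF v]]])
      fix k assume k: "k \<in> in_arcs S (v, n)"
      obtain e m where em: "k = (e, m)" by (cases k)
      have e: "e \<in> arcs G" "m \<le> p (Inl (tail G e))" and hd: "head G e = v" "p (Inr e) = n"
        using k by (auto simp: em in_arcs_S split_arcs_def)
      have tl: "tail G e \<in> verts G" using e by auto
      note D'k = qD(6)[OF e, unfolded hd] and De = diagram_arc[OF qD(1) e(1), unfolded hd]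
        and Ee = diagram_arc[OF rE(1) e(1), unfolded hd] and ae = a(1)[OF e(1), unfolded hd]
        and qt = qD(4)[OF tl e(2)] and Tt = component_hom[OF T tl]
      have "Comp C (Comp C (component T v) (q (v, n))) (at_arc D' k)
          = Comp C (Comp C (component T v) (at_arc D e)) (q (tail G e, m))"
        using comp_assoc[OF D'k qD(4)[OF v] Tv] comp_assoc[OF qt De Tv] qD(5)[OF e] hd by (simp add: em)
      also have "\<dots> = Comp C (at_arc E e) (Comp C (component T (tail G e)) (q (tail G e, m)))"
        using component_square[OF T e(1)] comp_assoc[OF qt Tt Ee] hd by simp
      also have "\<dots> = Comp C (r (v, n)) (b k)"
        using comp_assoc[OF comp_hom[OF qt Tt] ae rE(4)[OF v]] ra[OF e(1)] hd by (simp add: b_def em)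
      also have "\<dots> = Comp C (Comp C (r (v, n)) t) (at_arc D' k)"
        using comp_assoc[OF D'k t(1) rE(4)[OF v]] t(2)[OF k] by (simp add: em)
      finally show "Comp C (Comp C (component T v) (q (v, n))) (at_arc D' k) =
          Comp C (Comp C (r (v, n)) t) (at_arc D' k)" .
    qed
    with t show ?thesis by blast
  qed
  then obtain t' where t': "\<And>v n. \<lbrakk>v \<in> verts G; n \<le> p (Inl v)\<rbrakk> \<Longrightarrow>
      t' v n \<in> Hom C (at_vert D' (v, n)) (at_vert E' (v, n)) \<and>
      Comp C (component T v) (q (v, n)) = Comp C (r (v, n)) (t' v n) \<and>
      (\<forall>k\<in>in_arcs S (v, n). Comp C (t' v n) (at_arc D' k) = b k)"
    by metis
  define t where "t = (\<lambda>(v, n). t' v n)"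
  have t: "t w \<in> Hom C (at_vert D' w) (at_vert E' w)"
    "Comp C (component T (fst w)) (q w) = Comp C (r w) (t w)"
    "\<And>k. k \<in> in_arcs S w \<Longrightarrow> Comp C (t w) (at_arc D' k) = b k"
    if "w \<in> verts S" for w
    using that t'[of "fst w" "snd w"] by (auto simp: t_def verts_S split: prod.splits)
  obtain T' where T': "T' \<in> Hom (Diag_coprod C S) D' E'" "\<And>w. w \<in> verts S \<Longrightarrow> component T' w = t w"
  proof (rule diagram_mor_of_components[OF qD(2) rE(2) wf_S t(1)])
    fix k assume k: "k \<in> arcs S"
    obtain e m where em: "k = (e, m)" by (cases k)
    have e: "e \<in> arcs G" "m \<le> p (Inl (tail G e))" using k by (auto simp: em arcs_S)
    have tl: "tail G e \<in> verts G" using e by auto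
    have "Comp C (t (head S k)) (at_arc D' k) = b k"
      using t(3)[OF arc_levels(3)[OF e], of k] k by (simp add: em head_S in_arcs_def)
    also have "\<dots> = Comp C (a e) (Comp C (r (tail G e, m)) (t (tail G e, m)))"
      using t(2)[OF arc_levels(2)[OF e]] by (simp add: b_def em)
    also have "\<dots> = Comp C (at_arc E' k) (t (tail S k))"
      using comp_assoc[OF t(1)[OF arc_levels(2)[OF e]] rE(4)[OF tl e(2)] a(1)[OF e(1)]] a(2)[OF e]
      by (simp add: em tail_S)
    finally show "Comp C (t (head S k)) (at_arc D' k) = Comp C (at_arc E' k) (t (tail S k))" .
  qed blast+
  have lT': "link_mor q r T T'" using T'(2) t(2) by (simp add: link_mor_def)
  show ?thesis
  proof (rule ex1I)
    show "T' \<in> Hom (Diag_coprod C S) D' E' \<and> link_mor q r T T'" using T'(1) lT' by simp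
    fix U assume U: "U \<in> Hom (Diag_coprod C S) D' E' \<and> link_mor q r T U"
    show "U = T'"
    proof (rule diagram_mor_eqI[of _ _ _ D' E'])
      fix w assume w: "w \<in> verts S"
      obtain v n where vn: "w = (v, n)" by (cases w)
      have v: "v \<in> verts G" "n \<le> p (Inl v)" using w by (auto simp: vn verts_S)
      note Uw = component_hom[OF conjunct1[OF U] w, unfolded vn] and T'w = component_hom[OF T'(1) w, unfolded vn]
      have "component U (v, n) = component T' (v, n)"
      proof (cases "is_source G v")
        case True
        obtain s where s: "s \<in> Hom C (at_vert E v) (at_vert E' (v, n))"
          "Comp C s (r (v, n)) = Ident C (at_vert E' (v, n))"
          using r_iso[OF v True] by (auto simp: is_iso_def)
        have "component U (v, n) = Comp C s (Comp C (r (v, n)) (component U (v, n)))"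
          using comp_assoc[OF Uw rE(4)[OF v] s(1)] s(2) comp_id_left[OF Uw] by simp
        also have "Comp C (r (v, n)) (component U (v, n)) = Comp C (r (v, n)) (component T' (v, n))"
          using conjunct2[OF U] lT' w unfolding link_mor_def vn by (metis fst_conv)
        also have "Comp C s \<dots> = component T' (v, n)"
          using comp_assoc[OF T'w rE(4)[OF v] s(1)] s(2) comp_id_left[OF T'w] by simp
        finally show ?thesis .
      next
        case False
        show ?thesis
        proof (rule coproduct_ext[OF cop[OF v False] Uw T'w])
          fix k assume "k \<in> in_arcs S (v, n)"
          then show "Comp C (component U (v, n)) (at_arc D' k) = Comp C (component T' (v, n)) (at_arc D' k)"
            using b_forced[OF conjunct1[OF U] conjunct2[OF U], of "fst k" "snd k"]
              b_forced[OF T'(1) lT', of "fst k" "snd k"]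
            by (cases k) (auto simp: in_arcs_S split_arcs_def)
        qed
      qed
      then show "component U w = component T' w" by (simp add: vn)
    qed (use U T'(1) in simp_all)
  qed
qed

lemma link_mor_Ident:
  assumes q: "link D D' q"
  shows "link_mor q q (Ident (Diag_coprod C G) D) (Ident (Diag_coprod C S) D')"
proof -
  have "Comp C (Ident C (at_vert D v)) (q (v, n)) = Comp C (q (v, n)) (Ident C (at_vert D' (v, n)))"
    if "v \<in> verts G" "n \<le> p (Inl v)" for v n
    using comp_id_left[OF linkD(4)[OF q that]] comp_id_right[OF linkD(4)[OF q that]] by simp
  then show ?thesis by (auto simp: link_mor_def component_Ident verts_S)
qed

lemma link_mor_Comp:
  assumes q: "link D D' q" and r: "link E E' r" and s: "link F F' s"
    and T: "T \<in> Hom (Diag_coprod C G) D E" and U: "U \<in> Hom (Diag_coprod C G) E F"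
    and T': "T' \<in> Hom (Diag_coprod C S) D' E'" and U': "U' \<in> Hom (Diag_coprod C S) E' F'"
    and TT': "link_mor q r T T'" and UU': "link_mor r s U U'"
  shows "link_mor q s (Comp (Diag_coprod C G) U T) (Comp (Diag_coprod C S) U' T')"
  unfolding link_mor_def
proof
  fix w assume w: "w \<in> verts S"
  obtain v n where vn: "w = (v, n)" by (cases w)
  have v: "v \<in> verts G" "n \<le> p (Inl v)" using w by (auto simp: vn verts_S)
  note Tv = component_hom[OF T v(1)] and Uv = component_hom[OF U v(1)]
    and T'w = component_hom[OF T' w, unfolded vn] and U'w = component_hom[OF U' w, unfolded vn]
  have "Comp C (component T v) (q (v, n)) = Comp C (r (v, n)) (component T' (v, n))"
    "Comp C (component U v) (r (v, n)) = Comp C (s (v, n)) (component U' (v, n))"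
    using TT' UU' w by (auto simp: link_mor_def vn)
  then show "Comp C (component (Comp (Diag_coprod C G) U T) (fst w)) (q w) =
      Comp C (s w) (component (Comp (Diag_coprod C S) U' T') w)"
    using comp_assoc[OF linkD(4)[OF q v] Tv Uv] comp_assoc[OF T'w linkD(4)[OF r v] Uv]
      comp_assoc[OF T'w U'w linkD(4)[OF s v]] v w
    by (simp add: component_Comp vn)
qed

end

theorem theorem4p40:
  fixes G :: "('v, 'e) pre_digraph"
    and p :: "'v + 'e \<Rightarrow> nat"
    and C :: "('o, 'm) pre_category"
  assumes "wf_digraph G"
    and "verts G \<noteq> {}"
    and "\<And>v. v \<in> verts G \<Longrightarrow> \<not> infinite_receiver G v"
    and "\<And>e. e \<in> arcs G \<Longrightarrow> p (Inr e) \<le> p (Inl (head G e))"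
    and "\<And>v. \<lbrakk>v \<in> verts G; is_source G v\<rbrakk> \<Longrightarrow> p (Inl v) = 0"
    and "\<And>v. \<lbrakk>v \<in> verts G; \<not> is_source G v\<rbrakk>
      \<Longrightarrow> (\<lambda>e. p (Inr e)) ` in_arcs G v = {0..p (Inl v)}"
    and "category C"
    and "has_binary_coproducts C"
  shows "equivalent_categories (Diag_coprod C G) (Diag_coprod C (in_splitting G p))"
proof -
  interpret wf_digraph G by fact
  interpret category C by fact
  interpret in_splitting_data G C p
    by unfold_locales (use assms in auto)
  have fin: "finite (in_arcs G v)" if "v \<in> verts G" for v
    using assms(3)[OF that] by (simp add: infinite_receiver_def)
  interpret DG: category "Diag_coprod C G"
    by (rule category_Diag_coprod) fact+
  interpret DS: category "Diag_coprod C (in_splitting G p)"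
    by (rule category_Diag_coprod[OF _ wf_S]) fact
  interpret linked_categories "Diag_coprod C G" "Diag_coprod C (in_splitting G p)" link link_mor
  proof unfold_locales
    show "X \<in> Obj (Diag_coprod C G) \<and> Y \<in> Obj (Diag_coprod C (in_splitting G p))"
      if "link X Y l" for X Y l
      using linkD(1,2)[OF that] by simp
    show "\<exists>D' q. link D D' q" if "D \<in> Obj (Diag_coprod C G)" for D
      by (rule split_ex[OF assms(8) _ that]) (rule fin)
    show "\<exists>D q. link D D' q" if "D' \<in> Obj (Diag_coprod C (in_splitting G p))" for D'
      by (rule merge_ex[OF assms(8) that])
  qed (fact split_mor_ex1 merge_mor_ex1 link_mor_Ident link_mor_Comp)+
  show ?thesis by (rule equivalent_of_links)
qed

end
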